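(* Let $X$ and $Y$ be connected metric spaces, let $E\to X$ be a complex vector bundle of finite rank, and let $\pi\colon X\to Y$ be a covering space with a countable fiber $F$. Suppose there is an open cover $Y=\bigcup_{\lambda\in\Lambda}U_\lambda$ satisfying: (1) $\pi$ is trivial over each $U_\lambda$, so that $\pi^{-1}(U_\lambda)=\coprod_{x\in F}U_\lambda^x$, and $\pi\colon U_\lambda^x\to U_\lambda$ is an isometry for each $x\in F$; (2) $E$ is trivial on each $\pi^{-1}(U_\lambda)$; (3) for each $\lambda,\mu\in\Lambda$, the transition functions of $E$ on $U_\lambda^x\cap U_\mu^y$ for $x,y\in F$ are equicontinuous. Suppose further that $Y$ is compact. Then the pushforward $q\colon\pi_*E\to Y$ is a Hilbert bundle with end.
   Context: Vector bundles carry Hermitian metrics and trivializations are unitary. The pushforward of $E$ along $\pi$ is $\pi_*E=\coprod_{y\in Y}F_y$, where $F_y$ is the Hilbert space completion of $\bigoplus_{x\in\pi^{-1}(y)}E_x$, with $q(F_y)=y$, topologized by the local trivializations induced from those of $\pi$ and $E$ over the $U_\lambda$. A family of maps between metric spaces is equicontinuous if for any $\epsilon>0$ there is $\delta>0$ such that every member $f$ satisfies $d(f(a_1),f(a_2))<\epsilon$ whenever $d(a_1,a_2)<\delta$. Unitary groups are metrized by the operator norm. A Hilbert bundle is a locally trivial map with each fiber isometric to a Hilbert space $H$ and with transition functions continuous into the group of unitary operators on $H$ with the operator norm topology. Let $H$ have an orthonormal basis indexed by a countable metric space $J$. The propagation of a unitary $U=(U_{ij})_{i,j\in J}$ is $\sup\{d(i,j)\mid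 U_{ij}\ne0\}$; $\mathcal{U}_L(H)$ is the set of unitary operators of propagation $\le L$ with the operator norm topology, and $\mathcal{U}(H)=\bigcup_L\mathcal{U}_L(H)$ has the inductive limit topology. A Hilbert bundle with fiber $H$ has an end if its transition functions are continuous maps into $\mathcal{U}(H)$. Here $F$ is the fiber of $\pi$ over the basepoint of $Y$, a countable metric space as a subspace of $X$, and the basis of the typical fiber of $\pi_*E$ is indexed by $F$ (times a finite basis index for the fiber of $E$, at bounded mutual distance).
   Formalization: Adds that the changes of sheet labels between the U_λ are locally constant as permutations of F (automatic if Y is locally connected or F is finite); without this the claim fails. The sheets may be relabelled by one permutation of F per U_λ. *)

theory Defs
  imports "HOL-Analysis.Analysis"
begin

section \<open>The Hilbert space with an orthonormal basis indexed by a set\<close>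

text \<open>A vector of \<open>l2 J\<close> is its family of coordinates, extended by \<open>0\<close> outside \<open>J\<close>.
  Both the standard Hermitian space of dimension \<open>n\<close> (with \<open>J = {..<n}\<close>) and the typical fibre
  of the pushforward are of this form.\<close>

definition l2 :: "'j set \<Rightarrow> ('j \<Rightarrow> complex) set" where
  "l2 J = {f. (\<forall>j. j \<notin> J \<longrightarrow> f j = 0) \<and> (\<lambda>j. (cmod (f j))\<^sup>2) summable_on J}"

definition l2_inner :: "'j set \<Rightarrow> ('j \<Rightarrow> complex) \<Rightarrow> ('j \<Rightarrow> complex) \<Rightarrow> complex" where
  "l2_inner J f g = (\<Sum>\<^sub>\<infinity>j\<in>J. f j * cnj (g j))"

definition l2_norm :: "'j set \<Rightarrow> ('j \<Rightarrow> complex) \<Rightarrow> real" where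
  "l2_norm J f = sqrt (\<Sum>\<^sub>\<infinity>j\<in>J. (cmod (f j))\<^sup>2)"

definition l2_dist :: "'j set \<Rightarrow> ('j \<Rightarrow> complex) \<Rightarrow> ('j \<Rightarrow> complex) \<Rightarrow> real" where
  "l2_dist J f g = l2_norm J (\<lambda>j. f j - g j)"

definition l2_topology :: "'j set \<Rightarrow> ('j \<Rightarrow> complex) topology" where
  "l2_topology J = Metric_space.mtopology (l2 J) (l2_dist J)"

definition basis_vec :: "'j \<Rightarrow> 'j \<Rightarrow> complex" where
  "basis_vec j = (\<lambda>i. if i = j then 1 else 0)"


section \<open>Unitary operators, operator norm, finite propagation\<close>

type_synonym 'j operator = "('j \<Rightarrow> complex) \<Rightarrow> ('j \<Rightarrow> complex)"

definition unitaries :: "'j set \<Rightarrow> 'j operator set" where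
  "unitaries J = {T \<in> extensional (l2 J).
     bij_betw T (l2 J) (l2 J) \<and>
     (\<forall>f\<in>l2 J. \<forall>g\<in>l2 J. T (\<lambda>j. f j + g j) = (\<lambda>j. T f j + T g j)) \<and>
     (\<forall>c. \<forall>f\<in>l2 J. T (\<lambda>j. c * f j) = (\<lambda>j. c * T f j)) \<and>
     (\<forall>f\<in>l2 J. \<forall>g\<in>l2 J. l2_inner J (T f) (T g) = l2_inner J f g)}"

text \<open>The distance of two unitary operators in the operator norm. The supremum is meaningful only
  for bounded operators; elsewhere the value is \<open>0\<close>, so that \<open>op_dist J\<close> is nonnegative throughout,
  as the locale \<^locale>\<open>Metric_space\<close> demands.\<close>

definition op_dist :: "'j set \<Rightarrow> 'j operator \<Rightarrow> 'j operator \<Rightarrow> real" where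
  "op_dist J T T' = (if T \<in> unitaries J \<and> T' \<in> unitaries J
     then SUP f\<in>{f\<in>l2 J. l2_norm J f \<le> 1}. l2_dist J (T f) (T' f) else 0)"

definition unitary_topology :: "'j set \<Rightarrow> 'j operator topology" where
  "unitary_topology J = Metric_space.mtopology (unitaries J) (op_dist J)"

text \<open>The matrix entry of \<open>T\<close> at \<open>(i, j)\<close> is \<open>T (basis_vec j) i\<close>. The supremum is taken in
  \<^typ>\<open>ereal\<close>, so that it is \<open>\<infinity>\<close> for an operator of unbounded propagation.\<close>

definition propagation :: "'j set \<Rightarrow> ('j \<Rightarrow> 'j \<Rightarrow> real) \<Rightarrow> 'j operator \<Rightarrow> ereal" where
  "propagation J d T =
     (SUP (i, j)\<in>{(i, j). i \<in> J \<and> j \<in> J \<and> T (basis_vec j) i \<noteq> 0}. ereal (d i j))"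

definition unitaries_prop :: "'j set \<Rightarrow> ('j \<Rightarrow> 'j \<Rightarrow> real) \<Rightarrow> real \<Rightarrow> 'j operator set" where
  "unitaries_prop J d L = {T \<in> unitaries J. propagation J d T \<le> ereal L}"

definition unitaries_fin_prop :: "'j set \<Rightarrow> ('j \<Rightarrow> 'j \<Rightarrow> real) \<Rightarrow> 'j operator set" where
  "unitaries_fin_prop J d = (\<Union>L. unitaries_prop J d L)"

text \<open>The inductive limit of the subspaces \<open>unitaries_prop J d L\<close> of \<open>unitary_topology J\<close>.\<close>

definition end_topology :: "'j set \<Rightarrow> ('j \<Rightarrow> 'j \<Rightarrow> real) \<Rightarrow> 'j operator topology" where
  "end_topology J d = topology (\<lambda>W. W \<subseteq> unitaries_fin_prop J d \<and>
     (\<forall>L. openin (subtopology (unitary_topology J) (unitaries_prop J d L)) (W \<inter> unitaries_prop J d L)))"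

lemma openin_end_topology:
  "openin (end_topology J d) W \<longleftrightarrow> W \<subseteq> unitaries_fin_prop J d \<and>
     (\<forall>L. openin (subtopology (unitary_topology J) (unitaries_prop J d L)) (W \<inter> unitaries_prop J d L))"
proof -
  have "istopology (\<lambda>W. W \<subseteq> unitaries_fin_prop J d \<and>
     (\<forall>L. openin (subtopology (unitary_topology J) (unitaries_prop J d L)) (W \<inter> unitaries_prop J d L)))"
    unfolding istopology_def
  proof (intro conjI allI impI)
    fix S T L
    assume S: "S \<subseteq> unitaries_fin_prop J d \<and> (\<forall>L. openin (subtopology (unitary_topology J)
          (unitaries_prop J d L)) (S \<inter> unitaries_prop J d L))"
      and T: "T \<subseteq> unitaries_fin_prop J d \<and> (\<forall>L. openin (subtopology (unitary_topology J)
          (unitaries_prop J d L)) (T \<inter> unitaries_prop J d L))"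
    then show "S \<inter> T \<subseteq> unitaries_fin_prop J d" by blast
    have "S \<inter> T \<inter> unitaries_prop J d L = (S \<inter> unitaries_prop J d L) \<inter> (T \<inter> unitaries_prop J d L)"
      by blast
    then show "openin (subtopology (unitary_topology J) (unitaries_prop J d L))
        (S \<inter> T \<inter> unitaries_prop J d L)"
      using S T by (metis openin_Int)
  next
    fix \<K> L
    assume K: "\<forall>S\<in>\<K>. S \<subseteq> unitaries_fin_prop J d \<and> (\<forall>L. openin (subtopology (unitary_topology J)
          (unitaries_prop J d L)) (S \<inter> unitaries_prop J d L))"
    then show "\<Union>\<K> \<subseteq> unitaries_fin_prop J d" by blast
    have eq: "\<Union>\<K> \<inter> unitaries_prop J d L = \<Union>((\<lambda>S. S \<inter> unitaries_prop J d L) ` \<K>)" by blast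
    show "openin (subtopology (unitary_topology J) (unitaries_prop J d L))
        (\<Union>\<K> \<inter> unitaries_prop J d L)"
      unfolding eq using K by (intro openin_Union) blast
  qed
  then show ?thesis
    unfolding end_topology_def by (simp add: topology_inverse')
qed


section \<open>Families of Hilbert spaces over a base space and their trivializations\<close>

record ('b, 't) hfamily =
  total :: "'t topology"
  proj :: "'t \<Rightarrow> 'b"
  vadd :: "'t \<Rightarrow> 't \<Rightarrow> 't"
  vscale :: "complex \<Rightarrow> 't \<Rightarrow> 't"
  vinner :: "'t \<Rightarrow> 't \<Rightarrow> complex"

definition over :: "('b, 't) hfamily \<Rightarrow> 'b set \<Rightarrow> 't set" where
  "over B V = {e \<in> topspace (total B). proj B e \<in> V}"

abbreviation fiber :: "('b, 't) hfamily \<Rightarrow> 'b \<Rightarrow> 't set" where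
  "fiber B b \<equiv> over B {b}"

text \<open>\<open>\<phi>\<close> is the second component of the trivialization \<open>over B V \<cong> V \<times> l2 J\<close>. Being bijective on
  fibres by the first clause, it makes every fibre over \<open>V\<close> a Hilbert space isometric to \<open>l2 J\<close>.\<close>

definition unitary_trivialization ::
    "'j set \<Rightarrow> ('b::topological_space, 't) hfamily \<Rightarrow> 'b set \<Rightarrow> ('t \<Rightarrow> 'j \<Rightarrow> complex) \<Rightarrow> bool" where
  "unitary_trivialization J B V \<phi> \<longleftrightarrow>
     homeomorphic_map (subtopology (total B) (over B V))
       (prod_topology (top_of_set V) (l2_topology J)) (\<lambda>e. (proj B e, \<phi> e)) \<and>
     (\<forall>b\<in>V. \<forall>e\<in>fiber B b. \<forall>e'\<in>fiber B b.
        vadd B e e' \<in> fiber B b \<and> \<phi> (vadd B e e') = (\<lambda>j. \<phi> e j + \<phi> e' j) \<and>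
        (\<forall>c. vscale B c e \<in> fiber B b \<and> \<phi> (vscale B c e) = (\<lambda>j. c * \<phi> e j)) \<and>
        vinner B e e' = l2_inner J (\<phi> e) (\<phi> e'))"

text \<open>The transition function \<open>\<phi> \<circ> \<psi>\<^sup>-\<^sup>1\<close> at the base point \<open>b\<close>.\<close>

definition transition :: "'j set \<Rightarrow> ('b, 't) hfamily \<Rightarrow> ('t \<Rightarrow> 'j \<Rightarrow> complex) \<Rightarrow>
    ('t \<Rightarrow> 'j \<Rightarrow> complex) \<Rightarrow> 'b \<Rightarrow> 'j operator" where
  "transition J B \<phi> \<psi> b = (\<lambda>v\<in>l2 J. \<phi> (inv_into (fiber B b) \<psi> v))"

definition hermitian_vector_bundle :: "nat \<Rightarrow> ('b::topological_space, 't) hfamily \<Rightarrow> bool" where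
  "hermitian_vector_bundle n B \<longleftrightarrow>
     continuous_map (total B) euclidean (proj B) \<and>
     (\<forall>b. \<exists>V \<phi>. open V \<and> b \<in> V \<and> unitary_trivialization {..<n} B V \<phi>)"

text \<open>A Hilbert bundle comes with its atlas of local trivializations. This matters: by Kuiper's
  theorem the mere existence of an atlas with prescribed transition functions would carry very
  little information.\<close>

definition hilbert_bundle :: "'j set \<Rightarrow> ('b::topological_space, 't) hfamily \<Rightarrow>
    'l set \<Rightarrow> ('l \<Rightarrow> 'b set) \<Rightarrow> ('l \<Rightarrow> 't \<Rightarrow> 'j \<Rightarrow> complex) \<Rightarrow> bool" where
  "hilbert_bundle J B \<Lambda> U \<Phi> \<longleftrightarrow>
     continuous_map (total B) euclidean (proj B) \<and>
     (\<forall>l\<in>\<Lambda>. open (U l)) \<and> (\<Union>l\<in>\<Lambda>. U l) = UNIV \<and>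
     (\<forall>l\<in>\<Lambda>. unitary_trivialization J B (U l) (\<Phi> l)) \<and>
     (\<forall>l\<in>\<Lambda>. \<forall>m\<in>\<Lambda>. continuous_map (top_of_set (U l \<inter> U m)) (unitary_topology J)
        (transition J B (\<Phi> l) (\<Phi> m)))"

definition hilbert_bundle_with_end :: "'j set \<Rightarrow> ('j \<Rightarrow> 'j \<Rightarrow> real) \<Rightarrow>
    ('b::topological_space, 't) hfamily \<Rightarrow>
    'l set \<Rightarrow> ('l \<Rightarrow> 'b set) \<Rightarrow> ('l \<Rightarrow> 't \<Rightarrow> 'j \<Rightarrow> complex) \<Rightarrow> bool" where
  "hilbert_bundle_with_end J d B \<Lambda> U \<Phi> \<longleftrightarrow>
     countable J \<and> Metric_space J d \<and> hilbert_bundle J B \<Lambda> U \<Phi> \<and>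
     (\<forall>l\<in>\<Lambda>. \<forall>m\<in>\<Lambda>. continuous_map (top_of_set (U l \<inter> U m)) (end_topology J d)
        (transition J B (\<Phi> l) (\<Phi> m)))"

definition equicontinuous_family ::
    "'i set \<Rightarrow> ('i \<Rightarrow> 'a::metric_space set) \<Rightarrow> ('c \<Rightarrow> 'c \<Rightarrow> real) \<Rightarrow> ('i \<Rightarrow> 'a \<Rightarrow> 'c) \<Rightarrow> bool" where
  "equicontinuous_family I D d f \<longleftrightarrow>
     (\<forall>\<epsilon>>0. \<exists>\<delta>>0. \<forall>i\<in>I. \<forall>a\<in>D i. \<forall>b\<in>D i. dist a b < \<delta> \<longrightarrow> d (f i a) (f i b) < \<epsilon>)"


section \<open>Trivializations of coverings\<close>

definition covering_trivialization ::
    "('x::topological_space \<Rightarrow> 'y::topological_space) \<Rightarrow> 'f set \<Rightarrow> 'y set \<Rightarrow> ('f \<Rightarrow> 'x set) \<Rightarrow> bool" where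
  "covering_trivialization \<pi> F V S \<longleftrightarrow>
     disjoint_family_on S F \<and> (\<Union>x\<in>F. S x) = \<pi> -` V \<and>
     (\<forall>x\<in>F. open (S x) \<and> (\<exists>g. homeomorphism (S x) V \<pi> g))"

text \<open>The permutation of \<open>F\<close> sending \<open>x\<close> to the \<open>x'\<close> for which the point of \<open>S x\<close> over \<open>y\<close> lies
  in \<open>S' x'\<close>.\<close>

definition sheet_transition ::
    "('x \<Rightarrow> 'y) \<Rightarrow> 'f set \<Rightarrow> ('f \<Rightarrow> 'x set) \<Rightarrow> ('f \<Rightarrow> 'x set) \<Rightarrow> 'y \<Rightarrow> 'f \<Rightarrow> 'f" where
  "sheet_transition \<pi> F S S' y = (\<lambda>x\<in>F. THE x'. x' \<in> F \<and> inv_into (S x) \<pi> y \<in> S' x')"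

text \<open>A covering with fibre \<open>F\<close> is taken as a fibre bundle with discrete structure group: the
  transition functions of its trivializations are locally constant, as maps into the permutations
  of \<open>F\<close>. Over a locally connected base this is automatic, see
  \<open>sheet_transition_locally_constant\<close> below. In general, and for infinite \<open>F\<close>, openness of the
  sheets only makes \<open>sheet_transition \<pi> F S S' y x\<close> locally constant in \<open>y\<close> for each separate
  \<open>x\<close>; as two different permutation operators have distance at least \<open>\<surd>2\<close> in the operator norm,
  a pushforward along such a map need not have norm continuous transition functions.
  An example is the suspension of \<open>{0} \<union> {1/k | k \<ge> 1}\<close>, with two cones as \<open>U l\<close>, fibre \<open>\<nat>\<close>, and
  the sheet transition over \<open>1/k\<close> exchanging \<open>k\<close> and \<open>k + 1\<close>.\<close>

definition covering_atlas :: "('x::topological_space \<Rightarrow> 'y::topological_space) \<Rightarrow> 'f set \<Rightarrow>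
    'l set \<Rightarrow> ('l \<Rightarrow> 'y set) \<Rightarrow> ('l \<Rightarrow> 'f \<Rightarrow> 'x set) \<Rightarrow> bool" where
  "covering_atlas \<pi> F \<Lambda> U S \<longleftrightarrow>
     (\<forall>l\<in>\<Lambda>. covering_trivialization \<pi> F (U l) (S l)) \<and>
     (\<forall>l\<in>\<Lambda>. \<forall>m\<in>\<Lambda>. continuous_map (top_of_set (U l \<inter> U m)) (discrete_topology UNIV)
        (sheet_transition \<pi> F (S l) (S m)))"

lemma sheet_transition_locally_constant:
  fixes \<pi> :: "'x::topological_space \<Rightarrow> 'y::topological_space"
  assumes lc: "locally connected (UNIV :: 'y set)"
    and S: "covering_trivialization \<pi> F U S" and S': "covering_trivialization \<pi> F U' S'"
    and U: "open U" and U': "open U'"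
  shows "continuous_map (top_of_set (U \<inter> U')) (discrete_topology UNIV)
           (sheet_transition \<pi> F S S')"
proof -
  let ?t = "sheet_transition \<pi> F S S'"
  have ex: "\<exists>V. openin (top_of_set (U \<inter> U')) V \<and> y \<in> V \<and> V \<subseteq> U \<inter> U' \<and> (\<forall>z\<in>V. ?t z = ?t y)"
    if y: "y \<in> U \<inter> U'" for y
  proof -
    obtain V where V: "open V" "connected V" "y \<in> V" "V \<subseteq> U \<inter> U'"
      using lc y open_Int[OF U U'] unfolding locally_connected by (metis open_openin subtopology_UNIV)
    have "?t z = ?t y" if z: "z \<in> V" for z
    proof -
      have "(inv_into (S x) \<pi> z \<in> S' x') = (inv_into (S x) \<pi> y \<in> S' x')"
        if x: "x \<in> F" and x': "x' \<in> F" for x x'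
      proof -
        obtain g where g: "homeomorphism (S x) U \<pi> g"
          using S x unfolding covering_trivialization_def by blast
        have inj: "inj_on \<pi> (S x)" using g unfolding homeomorphism_def by (metis inj_onI)
        have gV: "g w \<in> S x" "\<pi> (g w) = w" if "w \<in> V" for w
        proof -
          have "w \<in> U" using that V by blast
          then show "g w \<in> S x" "\<pi> (g w) = w" using g unfolding homeomorphism_def by auto
        qed
        have gi: "inv_into (S x) \<pi> w = g w" if "w \<in> V" for w
          using inv_into_f_eq[OF inj gV[OF that]] .
        have "continuous_on V g"
          using V by (intro continuous_on_subset[OF homeomorphism_cont2[OF g]]) blast
        then have conn: "connected (g ` V)" using V connected_continuous_image by blast
        have "g ` V \<subseteq> \<pi> -` U'" using V gV by auto
        then have sub: "g ` V \<subseteq> (\<Union>x\<in>F. S' x)"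
          using S' unfolding covering_trivialization_def by blast
        have o1: "open (S' x')" and o2: "open (\<Union>w\<in>F - {x'}. S' w)"
          using S' x' unfolding covering_trivialization_def by auto
        have dj: "S' x' \<inter> (\<Union>w\<in>F - {x'}. S' w) = {}"
          using S' x' unfolding covering_trivialization_def disjoint_family_on_def by blast
        have cov: "g ` V \<subseteq> S' x' \<union> (\<Union>w\<in>F - {x'}. S' w)" using sub by blast
        have "S' x' \<inter> g ` V = {} \<or> (\<Union>w\<in>F - {x'}. S' w) \<inter> g ` V = {}"
          using connectedD[OF conn o1 o2 _ cov] dj by blast
        then have "(g z \<in> S' x') = (g y \<in> S' x')" using cov z V(3) by blast
        then show ?thesis using gi z V(3) by simp
      qed
      then have eq: "(x' \<in> F \<and> inv_into (S x) \<pi> z \<in> S' x') = (x' \<in> F \<and> inv_into (S x) \<pi> y \<in> S' x')"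
        if "x \<in> F" for x x' using that by blast
      show ?thesis unfolding sheet_transition_def
        by (rule restrict_ext) (simp only: eq)
    qed
    moreover have "openin (top_of_set (U \<inter> U')) V"
      using V unfolding openin_open by blast
    ultimately show ?thesis using V by blast
  qed
  show ?thesis
    unfolding continuous_map
  proof (intro conjI allI impI)
    fix W
    have ex2: "\<exists>V. openin (top_of_set (U \<inter> U')) V \<and> y \<in> V \<and>
        V \<subseteq> {x \<in> topspace (top_of_set (U \<inter> U')). ?t x \<in> W}"
      if "y \<in> {x \<in> topspace (top_of_set (U \<inter> U')). ?t x \<in> W}" for y
    proof -
      have y: "y \<in> U \<inter> U'" "?t y \<in> W" using that by auto
      obtain V where V: "openin (top_of_set (U \<inter> U')) V" "y \<in> V" "V \<subseteq> U \<inter> U'" "\<forall>z\<in>V. ?t z = ?t y"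
        using ex[OF y(1)] by blast
      have "V \<subseteq> {x \<in> topspace (top_of_set (U \<inter> U')). ?t x \<in> W}"
        using V(3,4) y(2) by auto
      then show ?thesis using V by blast
    qed
    show "openin (top_of_set (U \<inter> U')) {x \<in> topspace (top_of_set (U \<inter> U')). ?t x \<in> W}"
      by (rule openin_subopen[THEN iffD2], rule ballI, erule ex2)
  qed simp
qed


section \<open>The pushforward\<close>

text \<open>The completion of the algebraic direct sum of the \<open>fiber E x\<close>, \<open>x \<in> \<pi> -` {y}\<close>, is realized as
  their Hilbert space direct sum, the square summable sections over \<open>\<pi> -` {y}\<close>.\<close>

definition pushforward_space ::
    "('x, 'e) hfamily \<Rightarrow> ('x \<Rightarrow> 'y) \<Rightarrow> ('y \<times> ('x \<Rightarrow> 'e)) set" where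
  "pushforward_space E \<pi> = {(y, s). s \<in> (\<Pi>\<^sub>E x\<in>\<pi> -` {y}. fiber E x) \<and>
     (\<lambda>x. Re (vinner E (s x) (s x))) summable_on \<pi> -` {y}}"

text \<open>The trivialization of the pushforward over \<open>V\<close> induced from a trivialization of \<open>\<pi>\<close> over
  \<open>V\<close>, with sheets \<open>S\<close>, and a trivialization \<open>\<phi>\<close> of \<open>E\<close> over \<open>\<pi> -` V\<close>.\<close>

definition induced_trivialization ::
    "('x \<Rightarrow> 'y) \<Rightarrow> 'f set \<Rightarrow> ('f \<Rightarrow> 'x set) \<Rightarrow> ('e \<Rightarrow> nat \<Rightarrow> complex) \<Rightarrow>
     'y \<times> ('x \<Rightarrow> 'e) \<Rightarrow> 'f \<times> nat \<Rightarrow> complex" where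
  "induced_trivialization \<pi> F S \<phi> = (\<lambda>(y, s) (x, i).
     if x \<in> F then \<phi> (s (inv_into (S x) \<pi> y)) i else 0)"

text \<open>The metric on the index set \<open>F \<times> {..<n}\<close> of the basis of the typical fibre.\<close>

definition index_dist :: "'x::metric_space \<times> nat \<Rightarrow> 'x \<times> nat \<Rightarrow> real" where
  "index_dist = (\<lambda>(x, i) (x', i'). dist x x' + \<bar>real i - real i'\<bar>)"

definition pushforward :: "nat \<Rightarrow> ('x, 'e) hfamily \<Rightarrow> ('x \<Rightarrow> 'y::topological_space) \<Rightarrow> 'f set \<Rightarrow>
    'l set \<Rightarrow> ('l \<Rightarrow> 'y set) \<Rightarrow> ('l \<Rightarrow> 'f \<Rightarrow> 'x set) \<Rightarrow> ('l \<Rightarrow> 'e \<Rightarrow> nat \<Rightarrow> complex) \<Rightarrow>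
    ('y, 'y \<times> ('x \<Rightarrow> 'e)) hfamily" where
  "pushforward n E \<pi> F \<Lambda> U S \<phi> =
     \<lparr>total = topology_generated_by
        {{p \<in> pushforward_space E \<pi>. fst p \<in> U l \<and>
            (fst p, induced_trivialization \<pi> F (S l) (\<phi> l) p) \<in> W} | l W.
          l \<in> \<Lambda> \<and> openin (prod_topology (top_of_set (U l)) (l2_topology (F \<times> {..<n}))) W},
      proj = fst,
      vadd = (\<lambda>(y, s) (_, s'). (y, \<lambda>x\<in>\<pi> -` {y}. vadd E (s x) (s' x))),
      vscale = (\<lambda>c (y, s). (y, \<lambda>x\<in>\<pi> -` {y}. vscale E c (s x))),
      vinner = (\<lambda>(y, s) (_, s'). \<Sum>\<^sub>\<infinity>x\<in>\<pi> -` {y}. vinner E (s x) (s' x))\<rparr>"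

end

theory Submission
  imports Defs
begin

text \<open>The typical fibre of the pushforward is \<open>l2 (F \<times> {..<n})\<close>, the Hilbert space direct sum of copies
  of \<open>l2 {..<n}\<close> indexed by \<open>F\<close>.  Over \<open>y \<in> U l \<inter> U m\<close> the transition function of the induced
  trivializations is a permutation matrix with unitary blocks: the permutation compares the labels
  of the sheets over \<open>U l\<close> with those over \<open>U m\<close> (\<open>relabel\<close>), and the block in row \<open>x\<close> is the transition
  function of \<open>E\<close> at the point over \<open>y\<close> in the sheet labelled \<open>x\<close> (\<open>transition_P_slice\<close>).

  Norm continuity (\<open>continuous_transition_P\<close>): the permutation is locally constant, so the norm of
  \<open>T y - T z\<close> for \<open>z\<close> near \<open>y\<close> is the supremum of the norms of the differences of blocks.  The two
  points of \<open>X\<close> that belong to a block have distance \<open>dist y z\<close>, because sheets are isometric to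
  their images, so equicontinuity bounds all blocks at once.  The topology of the pushforward is
  generated by the charts, and norm continuous transition functions act continuously, so the charts
  are homeomorphisms (\<open>unitary_trivialization_chart\<close>).

  Finite propagation depends on the labels.  A labelling of the sheets over \<open>U l\<close> is good if the
  distance from \<open>x \<in> F\<close> to the points of the sheet labelled \<open>x\<close> is bounded independently of \<open>x\<close>.
  Two good labellings give transition functions of bounded propagation over the whole of
  \<open>U l \<inter> U m\<close>, by the triangle inequality at a common point of two sheets
  (\<open>propagation_transition_P\<close>); with norm continuity this gives continuity into the inductive limit.
  Good labellings exist (\<open>near_labelling_exists\<close>): when \<open>U l\<close> contains the basepoint, a sheet is
  labelled by its own point in \<open>F\<close>, and a good labelling is carried from \<open>U l\<close> to any \<open>U m\<close> that
  meets it, at the cost of the diameter of \<open>Y\<close>, which is finite by compactness.  Connectedness of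
  \<open>Y\<close> makes every nonempty \<open>U m\<close> reachable.\<close>

section \<open>Square summable families\<close>

lemma summable_on_l2: "f \<in> l2 J \<Longrightarrow> (\<lambda>j. (cmod (f j))\<^sup>2) summable_on J"
  and l2_outside: "f \<in> l2 J \<Longrightarrow> j \<notin> J \<Longrightarrow> f j = 0"
  by (auto simp: l2_def)

lemma l2I: "(\<And>j. j \<notin> J \<Longrightarrow> f j = 0) \<Longrightarrow> (\<lambda>j. (cmod (f j))\<^sup>2) summable_on J \<Longrightarrow> f \<in> l2 J"
  by (auto simp: l2_def)

lemma l2_finite: "finite K \<Longrightarrow> f \<in> l2 K \<longleftrightarrow> (\<forall>j. j \<notin> K \<longrightarrow> f j = 0)"
  by (auto simp: l2_def)

lemma l2_norm_nonneg: "0 \<le> l2_norm J f"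
  unfolding l2_norm_def by (simp add: infsum_nonneg)

lemma l2_norm_power2: "(l2_norm J f)\<^sup>2 = (\<Sum>\<^sub>\<infinity>j\<in>J. (cmod (f j))\<^sup>2)"
  unfolding l2_norm_def by (simp add: infsum_nonneg)

lemma l2_zero: "(\<lambda>j. 0) \<in> l2 J"
  by (simp add: l2_def)

lemma l2_norm_zero: "l2_norm J (\<lambda>j. 0) = 0"
  by (simp add: l2_norm_def)

lemma l2_scale: "f \<in> l2 J \<Longrightarrow> (\<lambda>j. c * f j) \<in> l2 J"
  by (auto simp: l2_def norm_mult power_mult_distrib intro: summable_on_cmult_right)

lemma l2_norm_scale: "l2_norm J (\<lambda>j. c * f j) = cmod c * l2_norm J f"
  unfolding l2_norm_def
  by (simp add: norm_mult power_mult_distrib infsum_cmult_right' real_sqrt_mult)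

lemma l2_norm_minus: "l2_norm J (\<lambda>j. - f j) = l2_norm J f"
  by (simp add: l2_norm_def)

lemma l2_add:
  assumes f: "f \<in> l2 J" and g: "g \<in> l2 J"
  shows "(\<lambda>j. f j + g j) \<in> l2 J"
proof (rule l2I)
  show "(\<lambda>j. (cmod (f j + g j))\<^sup>2) summable_on J"
  proof (rule summable_on_comparison_test)
    show "(\<lambda>j. 2 * (cmod (f j))\<^sup>2 + 2 * (cmod (g j))\<^sup>2) summable_on J"
      using f g by (intro summable_on_add summable_on_cmult_right) (auto simp: l2_def)
    fix j
    have "(cmod (f j + g j))\<^sup>2 \<le> (cmod (f j) + cmod (g j))\<^sup>2"
      by (simp add: norm_triangle_ineq power_mono)
    also have "\<dots> \<le> 2 * (cmod (f j))\<^sup>2 + 2 * (cmod (g j))\<^sup>2"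
      using sum_squares_bound[of "cmod (f j)" "cmod (g j)"] by (simp add: power2_sum)
    finally show "(cmod (f j + g j))\<^sup>2 \<le> 2 * (cmod (f j))\<^sup>2 + 2 * (cmod (g j))\<^sup>2" .
  qed simp
qed (use f g in \<open>auto simp: l2_def\<close>)

lemma l2_diff:
  assumes f: "f \<in> l2 J" and g: "g \<in> l2 J"
  shows "(\<lambda>j. f j - g j) \<in> l2 J"
  using l2_add[OF f l2_scale[OF g, of "-1"]] by simp

lemma summable_on_l2_mult:
  assumes f: "f \<in> l2 J" and g: "g \<in> l2 J"
  shows "(\<lambda>j. f j * cnj (g j)) summable_on J"
proof -
  have "(\<lambda>j. norm (f j * cnj (g j))) summable_on J"
    using f g by - (rule abs_summable_product; auto simp: l2_def norm_mult power2_eq_square)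
  then show ?thesis
    by (rule abs_summable_summable)
qed

lemma l2_norm_triangle:
  assumes f: "f \<in> l2 J" and g: "g \<in> l2 J"
  shows "l2_norm J (\<lambda>j. f j + g j) \<le> l2_norm J f + l2_norm J g"
proof -
  have part: "L2_set (\<lambda>j. cmod (h j)) A \<le> l2_norm J h"
    if "h \<in> l2 J" "finite A" "A \<subseteq> J" for h A
    unfolding L2_set_def l2_norm_def
    using that by (intro real_sqrt_le_mono finite_sum_le_infsum) (auto simp: l2_def)
  have "(\<Sum>\<^sub>\<infinity>j\<in>J. (cmod (f j + g j))\<^sup>2) \<le> (l2_norm J f + l2_norm J g)\<^sup>2"
  proof (rule infsum_le_finite_sums)
    show "(\<lambda>j. (cmod (f j + g j))\<^sup>2) summable_on J"
      using summable_on_l2[OF l2_add[OF f g]] .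
    fix A
    assume A: "finite A" "A \<subseteq> J"
    have "L2_set (\<lambda>j. cmod (f j + g j)) A \<le> L2_set (\<lambda>j. cmod (f j) + cmod (g j)) A"
      by (intro L2_set_mono) (auto simp: norm_triangle_ineq)
    also have "\<dots> \<le> L2_set (\<lambda>j. cmod (f j)) A + L2_set (\<lambda>j. cmod (g j)) A"
      by (rule L2_set_triangle_ineq)
    also have "\<dots> \<le> l2_norm J f + l2_norm J g"
      using part[OF f A] part[OF g A] by linarith
    finally have "sqrt (\<Sum>j\<in>A. (cmod (f j + g j))\<^sup>2) \<le> l2_norm J f + l2_norm J g"
      by (simp add: L2_set_def)
    then show "(\<Sum>j\<in>A. (cmod (f j + g j))\<^sup>2) \<le> (l2_norm J f + l2_norm J g)\<^sup>2"
      by (rule sqrt_le_D)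
  qed
  then show ?thesis
    unfolding l2_norm_def[of J "\<lambda>j. f j + g j"]
    by (intro real_le_lsqrt) (auto simp: l2_norm_nonneg intro: add_nonneg_nonneg)
qed

lemma l2_norm_eq_0:
  assumes f: "f \<in> l2 J" and "l2_norm J f = 0"
  shows "f = (\<lambda>j. 0)"
proof
  fix j
  have "(\<Sum>\<^sub>\<infinity>j\<in>J. (cmod (f j))\<^sup>2) = 0"
    using assms(2) l2_norm_power2[of J f] by simp
  then have "(cmod (f j))\<^sup>2 = 0" if "j \<in> J"
    using nonneg_infsum_le_0D[OF _ summable_on_l2[OF f] _ that] by simp
  then show "f j = 0"
    using l2_outside[OF f] by (cases "j \<in> J") auto
qed

lemma l2_dist_triangle:
  assumes "f \<in> l2 J" "g \<in> l2 J" "h \<in> l2 J"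
  shows "l2_dist J f h \<le> l2_dist J f g + l2_dist J g h"
  using l2_norm_triangle[OF l2_diff[OF assms(1,2)] l2_diff[OF assms(2,3)]]
  by (simp add: l2_dist_def)

lemma l2_dist_commute: "l2_dist J f g = l2_dist J g f"
  unfolding l2_dist_def l2_norm_def by (simp add: norm_minus_commute)

lemma Metric_space_l2: "Metric_space (l2 J) (l2_dist J)"
proof
  fix f g h
  show "0 \<le> l2_dist J f g"
    by (simp add: l2_dist_def l2_norm_nonneg)
  show "l2_dist J f g = l2_dist J g f"
    by (rule l2_dist_commute)
  show "(l2_dist J f g = 0) = (f = g)" if "f \<in> l2 J" "g \<in> l2 J"
  proof
    assume "l2_dist J f g = 0"
    then have "(\<lambda>j. f j - g j) = (\<lambda>j. 0)"
      unfolding l2_dist_def using l2_norm_eq_0 l2_diff[OF that] by blast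
    then show "f = g"
      by (simp add: fun_eq_iff)
  qed (simp add: l2_dist_def l2_norm_zero)
  show "l2_dist J f h \<le> l2_dist J f g + l2_dist J g h"
    if "f \<in> l2 J" "g \<in> l2 J" "h \<in> l2 J"
    using l2_dist_triangle[OF that] .
qed

lemma topspace_l2_topology [simp]: "topspace (l2_topology J) = l2 J"
  unfolding l2_topology_def by (simp add: Metric_space.topspace_mtopology[OF Metric_space_l2])

lemma l2_inner_self:
  assumes f: "f \<in> l2 J"
  shows "l2_inner J f f = complex_of_real ((l2_norm J f)\<^sup>2)"
proof -
  have "l2_inner J f f = (\<Sum>\<^sub>\<infinity>j\<in>J. complex_of_real ((cmod (f j))\<^sup>2))"
    unfolding l2_inner_def by (simp only: complex_norm_square)
  also have "\<dots> = complex_of_real ((l2_norm J f)\<^sup>2)"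
    unfolding l2_norm_power2
    by (rule infsumI[OF has_sum_of_real[OF has_sum_infsum[OF summable_on_l2[OF f]]]])
  finally show ?thesis .
qed

text \<open>By Fubini, \<open>l2 (F \<times> K)\<close> is the Hilbert space direct sum of copies of \<open>l2 K\<close> indexed by
  \<open>F\<close>. Square summability of a section of a bundle along a fibre of the covering turns in this way
  into square summability of coordinates.\<close>

lemma l2_Times_finite:
  assumes K: "finite K"
  shows "f \<in> l2 (F \<times> K) \<longleftrightarrow>
    (\<forall>x i. (x, i) \<notin> F \<times> K \<longrightarrow> f (x, i) = 0) \<and>
    (\<lambda>x. (l2_norm K (\<lambda>i. f (x, i)))\<^sup>2) summable_on F"
proof -
  have "(\<lambda>p. (cmod (f p))\<^sup>2) summable_on F \<times> K \<longleftrightarrow>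
      (\<lambda>p. norm ((cmod (f p))\<^sup>2)) summable_on F \<times> K"
    by simp
  also have "\<dots> \<longleftrightarrow> (\<lambda>x. (l2_norm K (\<lambda>i. f (x, i)))\<^sup>2) summable_on F"
    using K by (subst Infinite_Sum.abs_summable_on_Sigma_iff) (simp add: l2_norm_power2 infsum_nonneg sum_nonneg)
  finally show ?thesis
    unfolding l2_def by auto
qed

lemma l2_slice:
  assumes K: "finite K" and f: "f \<in> l2 (F \<times> K)"
  shows "(\<lambda>i. f (x, i)) \<in> l2 K"
  using f by (auto simp: l2_finite[OF K] l2_Times_finite[OF K])

lemma l2_norm_Times_finite:
  assumes K: "finite K" and f: "f \<in> l2 (F \<times> K)"
  shows "(l2_norm (F \<times> K) f)\<^sup>2 = (\<Sum>\<^sub>\<infinity>x\<in>F. (l2_norm K (\<lambda>i. f (x, i)))\<^sup>2)"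
  unfolding l2_norm_power2
  using infsum_Sigma_banach[OF summable_on_l2[OF f]] by simp

lemma l2_inner_Times_finite:
  assumes K: "finite K" and f: "f \<in> l2 (F \<times> K)" and g: "g \<in> l2 (F \<times> K)"
  shows "l2_inner (F \<times> K) f g = (\<Sum>\<^sub>\<infinity>x\<in>F. l2_inner K (\<lambda>i. f (x, i)) (\<lambda>i. g (x, i)))"
  unfolding l2_inner_def
  using infsum_Sigma_banach[OF summable_on_l2_mult[OF f g]] by simp

section \<open>Unitary operators and the operator norm\<close>

lemma unitary_l2: "T \<in> unitaries J \<Longrightarrow> f \<in> l2 J \<Longrightarrow> T f \<in> l2 J"
  by (auto simp: unitaries_def bij_betw_def)

lemma unitary_add:
  "T \<in> unitaries J \<Longrightarrow> f \<in> l2 J \<Longrightarrow> g \<in> l2 J \<Longrightarrow> T (\<lambda>j. f j + g j) = (\<lambda>j. T f j + T g j)"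
  by (auto simp: unitaries_def)

lemma unitary_scale: "T \<in> unitaries J \<Longrightarrow> f \<in> l2 J \<Longrightarrow> T (\<lambda>j. c * f j) = (\<lambda>j. c * T f j)"
  by (auto simp: unitaries_def)

lemma unitary_zero: "T \<in> unitaries J \<Longrightarrow> T (\<lambda>j. 0) = (\<lambda>j. 0)"
  using unitary_scale[of T J "\<lambda>j. 0" 0] l2_zero[of J] by simp

lemma unitary_diff:
  assumes T: "T \<in> unitaries J" and f: "f \<in> l2 J" and g: "g \<in> l2 J"
  shows "T (\<lambda>j. f j - g j) = (\<lambda>j. T f j - T g j)"
proof -
  have "T (\<lambda>j. f j + (- 1) * g j) = (\<lambda>j. T f j + T (\<lambda>j. (- 1) * g j) j)"
    by (rule unitary_add[OF T f l2_scale[OF g]])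
  then show ?thesis
    by (simp only: unitary_scale[OF T g]) simp
qed

lemma unitary_norm:
  assumes T: "T \<in> unitaries J" and f: "f \<in> l2 J"
  shows "l2_norm J (T f) = l2_norm J f"
proof -
  have "l2_inner J (T f) (T f) = l2_inner J f f"
    using assms by (auto simp: unitaries_def)
  then have "(l2_norm J (T f))\<^sup>2 = (l2_norm J f)\<^sup>2"
    by (simp only: l2_inner_self unitary_l2[OF T] f of_real_eq_iff)
  then show ?thesis
    by (simp add: l2_norm_nonneg)
qed

lemma unitary_dist:
  assumes T: "T \<in> unitaries J" and f: "f \<in> l2 J" and g: "g \<in> l2 J"
  shows "l2_dist J (T f) (T g) = l2_dist J f g"
  using unitary_norm[OF T l2_diff[OF f g]] by (simp add: l2_dist_def unitary_diff[OF assms])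

lemma op_dist_bound_unit_ball:
  assumes T: "T \<in> unitaries J" and T': "T' \<in> unitaries J" and f: "f \<in> l2 J" "l2_norm J f \<le> 1"
  shows "l2_dist J (T f) (T' f) \<le> op_dist J T T'"
proof -
  have "bdd_above ((\<lambda>f. l2_dist J (T f) (T' f)) ` {f \<in> l2 J. l2_norm J f \<le> 1})"
  proof (rule bdd_aboveI2)
    fix f
    assume "f \<in> {f \<in> l2 J. l2_norm J f \<le> 1}"
    then have f: "f \<in> l2 J" "l2_norm J f \<le> 1"
      by auto
    have "l2_dist J (T f) (T' f) \<le> l2_dist J (T f) (\<lambda>j. 0) + l2_dist J (\<lambda>j. 0) (T' f)"
      by (intro l2_dist_triangle unitary_l2[OF T] unitary_l2[OF T'] f l2_zero)
    also have "\<dots> = l2_norm J (T f) + l2_norm J (T' f)"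
      by (simp add: l2_dist_def l2_norm_minus)
    finally show "l2_dist J (T f) (T' f) \<le> 2"
      using f by (simp add: unitary_norm T T')
  qed
  then show ?thesis
    using assms unfolding op_dist_def by (auto intro: cSUP_upper)
qed

lemma op_dist_bound:
  assumes T: "T \<in> unitaries J" and T': "T' \<in> unitaries J" and f: "f \<in> l2 J"
  shows "l2_dist J (T f) (T' f) \<le> op_dist J T T' * l2_norm J f"
proof (cases "l2_norm J f = 0")
  case True
  then have "f = (\<lambda>j. 0)"
    using l2_norm_eq_0[OF f] by blast
  then show ?thesis
    using True by (simp add: unitary_zero[OF T] unitary_zero[OF T'] l2_dist_def l2_norm_zero)
next
  case False
  define r where "r = l2_norm J f"
  have r: "r > 0"
    using False l2_norm_nonneg[of J f] by (simp add: r_def)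
  define h where "h = (\<lambda>j. complex_of_real (1 / r) * f j)"
  have h: "h \<in> l2 J" "l2_norm J h = 1"
    unfolding h_def using r by (simp_all only: l2_scale[OF f] l2_norm_scale) (simp add: r_def norm_divide)
  have "l2_dist J (T h) (T' h) = 1 / r * l2_dist J (T f) (T' f)"
    unfolding h_def unitary_scale[OF T f] unitary_scale[OF T' f] l2_dist_def
    using r l2_norm_scale[of J "complex_of_real (1 / r)" "\<lambda>j. T f j - T' f j"]
    by (simp add: algebra_simps norm_divide)
  then show ?thesis
    using op_dist_bound_unit_ball[OF T T' h(1)] h(2) r by (simp add: r_def field_simps)
qed

lemma op_dist_le:
  assumes "0 \<le> C"
    and "\<And>f. f \<in> l2 J \<Longrightarrow> l2_dist J (T f) (T' f) \<le> C * l2_norm J f"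
  shows "op_dist J T T' \<le> C"
proof -
  have "(SUP f\<in>{f\<in>l2 J. l2_norm J f \<le> 1}. l2_dist J (T f) (T' f)) \<le> C"
  proof (rule cSUP_least)
    show "{f \<in> l2 J. l2_norm J f \<le> 1} \<noteq> {}"
      using l2_zero[of J] by (auto simp: l2_norm_zero intro!: exI[of _ "\<lambda>j. 0"])
    fix f
    assume "f \<in> {f \<in> l2 J. l2_norm J f \<le> 1}"
    then show "l2_dist J (T f) (T' f) \<le> C"
      using assms(2)[of f] mult_left_mono[of "l2_norm J f" 1 C] assms(1) by simp
  qed
  then show ?thesis
    using assms(1) by (simp add: op_dist_def)
qed

lemma op_dist_nonneg: "0 \<le> op_dist J T T'"
proof (cases "T \<in> unitaries J \<and> T' \<in> unitaries J")
  case True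
  then have "l2_dist J (T (\<lambda>j. 0)) (T' (\<lambda>j. 0)) \<le> op_dist J T T'"
    by (intro op_dist_bound_unit_ball l2_zero) (auto simp: l2_norm_zero)
  then show ?thesis
    using True unitary_zero[of T J] unitary_zero[of T' J] by (simp add: l2_dist_def l2_norm_zero)
qed (auto simp: op_dist_def)

lemma Metric_space_unitaries: "Metric_space (unitaries J) (op_dist J)"
proof
  fix T T' T''
  show "0 \<le> op_dist J T T'"
    by (rule op_dist_nonneg)
  show "op_dist J T T' = op_dist J T' T"
    unfolding op_dist_def by (simp add: l2_dist_commute conj_commute)
  show "(op_dist J T T' = 0) = (T = T')" if T: "T \<in> unitaries J" "T' \<in> unitaries J"
  proof
    assume 0: "op_dist J T T' = 0"
    show "T = T'"
    proof (rule extensionalityI)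
      show "T \<in> extensional (l2 J)" "T' \<in> extensional (l2 J)"
        using T by (auto simp: unitaries_def)
      fix f
      assume f: "f \<in> l2 J"
      have "l2_dist J (T f) (T' f) = 0"
        using op_dist_bound[OF T f] 0 by (simp add: l2_dist_def l2_norm_nonneg order.antisym)
      then show "T f = T' f"
        using Metric_space.zero[OF Metric_space_l2] unitary_l2 T f by blast
    qed
  next
    assume "T = T'"
    then have "op_dist J T T' \<le> 0"
      by (intro op_dist_le) (auto simp: l2_dist_def l2_norm_zero)
    then show "op_dist J T T' = 0"
      using op_dist_nonneg[of J T T'] by simp
  qed
  show "op_dist J T T'' \<le> op_dist J T T' + op_dist J T' T''"
    if T: "T \<in> unitaries J" "T' \<in> unitaries J" "T'' \<in> unitaries J"
  proof (rule op_dist_le)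
    fix f
    assume f: "f \<in> l2 J"
    have "l2_dist J (T f) (T'' f) \<le> l2_dist J (T f) (T' f) + l2_dist J (T' f) (T'' f)"
      by (intro l2_dist_triangle unitary_l2[OF _ f] T)
    also have "\<dots> \<le> op_dist J T T' * l2_norm J f + op_dist J T' T'' * l2_norm J f"
      by (intro add_mono op_dist_bound T f)
    finally show "l2_dist J (T f) (T'' f) \<le> (op_dist J T T' + op_dist J T' T'') * l2_norm J f"
      by (simp add: distrib_right)
  qed (simp add: op_dist_nonneg)
qed

lemma topspace_unitary_topology [simp]: "topspace (unitary_topology J) = unitaries J"
  unfolding unitary_topology_def
  by (simp add: Metric_space.topspace_mtopology[OF Metric_space_unitaries])

lemma continuous_map_into_unitary_topology:
  "continuous_map X (unitary_topology J) T \<longleftrightarrow> T ` topspace X \<subseteq> unitaries J \<and>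
    (\<forall>x\<in>topspace X. \<forall>\<epsilon>>0. \<exists>W. openin X W \<and> x \<in> W \<and> (\<forall>y\<in>W. op_dist J (T x) (T y) < \<epsilon>))"
  (is "?L \<longleftrightarrow> ?R")
proof -
  interpret Metric_space "unitaries J" "op_dist J"
    by (rule Metric_space_unitaries)
  show ?thesis
  proof
    assume L: ?L
    have "\<exists>W. openin X W \<and> x \<in> W \<and> (\<forall>y\<in>W. op_dist J (T x) (T y) < \<epsilon>)"
      if x: "x \<in> topspace X" "\<epsilon> > 0" for x \<epsilon>
    proof -
      obtain W where "openin X W" "x \<in> W" "\<forall>y\<in>W. T y \<in> mball (T x) \<epsilon>"
        using L x unfolding unitary_topology_def continuous_map_to_metric by meson
      then show ?thesis
        by (intro exI[of _ W]) simp
    qed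
    then show ?R
      using continuous_map_image_subset_topspace[OF L] by simp
  next
    assume R: ?R
    show ?L
      unfolding unitary_topology_def continuous_map_to_metric
    proof (intro ballI allI impI)
      fix x and \<epsilon> :: real
      assume "x \<in> topspace X" "\<epsilon> > 0"
      then obtain W where "openin X W" "x \<in> W" "\<forall>y\<in>W. op_dist J (T x) (T y) < \<epsilon>"
        using R by blast
      moreover have "T y \<in> unitaries J" if "y \<in> topspace X" for y
        using R that by blast
      ultimately show "\<exists>W. openin X W \<and> x \<in> W \<and> (\<forall>y\<in>W. T y \<in> mball (T x) \<epsilon>)"
        using openin_subset[OF \<open>openin X W\<close>] by (intro exI[of _ W]) auto
    qed
  qed
qed

text \<open>In \<open>T y v - T z w = (T y v - T z v) + T z (v - w)\<close> the first term is small by norm continuity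
  and the second has the norm of \<open>v - w\<close>.\<close>

lemma continuous_map_unitary_action:
  assumes T: "continuous_map X (unitary_topology J) T"
  shows "continuous_map (prod_topology X (l2_topology J)) (l2_topology J) (\<lambda>(y, v). T y v)"
proof -
  interpret l2: Metric_space "l2 J" "l2_dist J"
    by (rule Metric_space_l2)
  have TU: "T y \<in> unitaries J" if "y \<in> topspace X" for y
    using T that by (auto simp: continuous_map_into_unitary_topology)
  have "\<exists>N. openin (prod_topology X (l2_topology J)) N \<and> (y, v) \<in> N \<and>
      (\<forall>(z, w)\<in>N. T z w \<in> l2.mball (T y v) \<epsilon>)"
    if y: "y \<in> topspace X" and v: "v \<in> l2 J" and \<epsilon>: "\<epsilon> > 0" for y v and \<epsilon> :: real
  proof -
    define \<epsilon>' where "\<epsilon>' = \<epsilon> / 2 / (l2_norm J v + 1)"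
    have \<epsilon>': "\<epsilon>' > 0" "\<epsilon>' * l2_norm J v \<le> \<epsilon> / 2"
      using \<epsilon> l2_norm_nonneg[of J v] by (simp_all add: \<epsilon>'_def divide_simps)
    obtain W where W: "openin X W" "y \<in> W" "\<And>z. z \<in> W \<Longrightarrow> op_dist J (T y) (T z) < \<epsilon>'"
      using T y \<epsilon>'(1) unfolding continuous_map_into_unitary_topology by meson
    have "T z w \<in> l2.mball (T y v) \<epsilon>" if "z \<in> W" "w \<in> l2.mball v (\<epsilon> / 2)" for z w
    proof -
      have z: "z \<in> topspace X"
        using openin_subset[OF W(1)] that by blast
      have w: "w \<in> l2 J" "l2_dist J v w < \<epsilon> / 2"
        using that by (auto simp: l2.in_mball)
      have "l2_dist J (T y v) (T z w) \<le> l2_dist J (T y v) (T z v) + l2_dist J (T z v) (T z w)"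
        by (intro l2_dist_triangle unitary_l2[OF TU[OF y]] unitary_l2[OF TU[OF z]] v w)
      also have "l2_dist J (T y v) (T z v) \<le> op_dist J (T y) (T z) * l2_norm J v"
        by (intro op_dist_bound TU y z v)
      also have "\<dots> \<le> \<epsilon>' * l2_norm J v"
        using W(3)[OF \<open>z \<in> W\<close>] l2_norm_nonneg by (intro mult_right_mono) auto
      also note \<epsilon>'(2)
      also have "l2_dist J (T z v) (T z w) < \<epsilon> / 2"
        using unitary_dist[OF TU[OF z] v w(1)] w(2) by simp
      finally show ?thesis
        using unitary_l2[OF TU[OF y] v] unitary_l2[OF TU[OF z] w(1)] by (simp add: l2.in_mball)
    qed
    moreover have "openin (prod_topology X (l2_topology J)) (W \<times> l2.mball v (\<epsilon> / 2))"
      using W(1) by (simp add: openin_prod_Times_iff l2_topology_def)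
    moreover have "(y, v) \<in> W \<times> l2.mball v (\<epsilon> / 2)"
      using W(2) v \<epsilon> by (simp add: l2.in_mball)
    ultimately show ?thesis
      by (intro exI[of _ "W \<times> l2.mball v (\<epsilon> / 2)"]) auto
  qed
  then show ?thesis
    unfolding l2_topology_def[of J] l2.continuous_map_to_metric
    unfolding l2_topology_def[symmetric]
    by (auto simp: split_beta)
qed

text \<open>On a set of operators of propagation at most \<open>L\<close> the inductive limit topology is no finer than
  the norm topology, so a norm continuous map of bounded propagation is continuous into it.\<close>

lemma continuous_map_into_end_topology:
  assumes T: "continuous_map X (unitary_topology J) T"
    and L: "\<And>x. x \<in> topspace X \<Longrightarrow> propagation J d (T x) \<le> ereal L"
  shows "continuous_map X (end_topology J d) T"
proof -
  have TL: "T x \<in> unitaries_prop J d L" if "x \<in> topspace X" for x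
    using T L that by (auto simp: unitaries_prop_def continuous_map_into_unitary_topology)
  have cont: "continuous_map X (subtopology (unitary_topology J) (unitaries_prop J d L)) T"
    using T TL by (auto simp: continuous_map_in_subtopology)
  have "openin (end_topology J d) (unitaries_fin_prop J d)"
  proof -
    have "unitaries_fin_prop J d \<inter> unitaries_prop J d L =
        topspace (subtopology (unitary_topology J) (unitaries_prop J d L))" for L
      by (auto simp: unitaries_fin_prop_def unitaries_prop_def)
    then show ?thesis
      unfolding openin_end_topology by (metis openin_topspace order_refl)
  qed
  then have sub: "unitaries_fin_prop J d \<subseteq> topspace (end_topology J d)"
    by (rule openin_subset)
  show ?thesis
    unfolding continuous_map
  proof (intro conjI allI impI)
    show "T ` topspace X \<subseteq> topspace (end_topology J d)"
      using TL sub by (auto simp: unitaries_fin_prop_def)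
    fix W
    assume "openin (end_topology J d) W"
    then have "openin (subtopology (unitary_topology J) (unitaries_prop J d L)) (W \<inter> unitaries_prop J d L)"
      by (simp add: openin_end_topology)
    then have "openin X {x \<in> topspace X. T x \<in> W \<inter> unitaries_prop J d L}"
      by (rule openin_continuous_map_preimage[OF cont])
    moreover have "{x \<in> topspace X. T x \<in> W \<inter> unitaries_prop J d L} = {x \<in> topspace X. T x \<in> W}"
      using TL by auto
    ultimately show "openin X {x \<in> topspace X. T x \<in> W}"
      by simp
  qed
qed


section \<open>Trivializations on a single fibre\<close>

text \<open>The part of a unitary trivialization that concerns the single fibre over \<open>b\<close>.  It does not
  mention the topology of the total space; for the pushforward this allows the transition functions
  to be studied before the induced trivializations are known to be homeomorphisms.\<close>

definition fibre_isometry ::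
    "'j set \<Rightarrow> ('b, 't) hfamily \<Rightarrow> 'b \<Rightarrow> ('t \<Rightarrow> 'j \<Rightarrow> complex) \<Rightarrow> bool" where
  "fibre_isometry J B b \<phi> \<longleftrightarrow> bij_betw \<phi> (fiber B b) (l2 J) \<and>
     (\<forall>e\<in>fiber B b. \<forall>e'\<in>fiber B b.
        vadd B e e' \<in> fiber B b \<and> \<phi> (vadd B e e') = (\<lambda>j. \<phi> e j + \<phi> e' j) \<and>
        (\<forall>c. vscale B c e \<in> fiber B b \<and> \<phi> (vscale B c e) = (\<lambda>j. c * \<phi> e j)) \<and>
        vinner B e e' = l2_inner J (\<phi> e) (\<phi> e'))"

lemma topspace_over: "topspace (subtopology (total B) (over B V)) = over B V"
  by (auto simp: over_def)

lemma unitary_trivialization_imp_fibre_isometry: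
  assumes \<phi>: "unitary_trivialization J B V \<phi>" and b: "b \<in> V"
  shows "fibre_isometry J B b \<phi>"
proof -
  let ?f = "\<lambda>e. (proj B e, \<phi> e)"
  have hom: "homeomorphic_map (subtopology (total B) (over B V))
      (prod_topology (top_of_set V) (l2_topology J)) ?f"
    using \<phi> by (simp add: unitary_trivialization_def)
  have img: "?f ` over B V = V \<times> l2 J" and inj: "inj_on ?f (over B V)"
    using homeomorphic_imp_surjective_map[OF hom] homeomorphic_imp_injective_map[OF hom]
    by (simp_all only: topspace_over) simp
  have fib: "e \<in> over B V" "proj B e = b" if "e \<in> fiber B b" for e
    using that b by (auto simp: over_def)
  have "bij_betw \<phi> (fiber B b) (l2 J)"
  proof (rule bij_betw_imageI)
    show "inj_on \<phi> (fiber B b)"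
    proof (rule inj_onI)
      fix e e'
      assume e: "e \<in> fiber B b" "e' \<in> fiber B b" "\<phi> e = \<phi> e'"
      show "e = e'"
        by (rule inj_onD[OF inj _ fib(1)[OF e(1)] fib(1)[OF e(2)]]) (simp add: e(3) fib(2) e(1,2))
    qed
    show "\<phi> ` fiber B b = l2 J"
    proof
      show "\<phi> ` fiber B b \<subseteq> l2 J"
      proof (rule image_subsetI)
        fix e
        assume e: "e \<in> fiber B b"
        then have "?f e \<in> V \<times> l2 J"
          using img fib(1) by blast
        then show "\<phi> e \<in> l2 J"
          by simp
      qed
      show "l2 J \<subseteq> \<phi> ` fiber B b"
      proof
        fix v
        assume "v \<in> l2 J"
        then have "(b, v) \<in> ?f ` over B V"
          unfolding img using b by simp
        then obtain e where "e \<in> over B V" "proj B e = b" "\<phi> e = v"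
          by auto
        then show "v \<in> \<phi> ` fiber B b"
          by (auto simp: over_def)
      qed
    qed
  qed
  then show ?thesis
    using \<phi> b unfolding fibre_isometry_def unitary_trivialization_def by blast
qed

lemma fibre_isometry_l2: "fibre_isometry J B b \<phi> \<Longrightarrow> e \<in> fiber B b \<Longrightarrow> \<phi> e \<in> l2 J"
  by (auto simp: fibre_isometry_def bij_betw_def)

lemma fibre_isometry_inj:
  "fibre_isometry J B b \<phi> \<Longrightarrow> e \<in> fiber B b \<Longrightarrow> e' \<in> fiber B b \<Longrightarrow> \<phi> e = \<phi> e' \<Longrightarrow> e = e'"
  unfolding fibre_isometry_def bij_betw_def by (auto dest: inj_onD)

lemma fibre_isometry_inv:
  assumes "fibre_isometry J B b \<phi>" "v \<in> l2 J"
  shows "inv_into (fiber B b) \<phi> v \<in> fiber B b" "\<phi> (inv_into (fiber B b) \<phi> v) = v"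
proof -
  have "v \<in> \<phi> ` fiber B b"
    using assms by (auto simp: fibre_isometry_def bij_betw_def)
  then show "inv_into (fiber B b) \<phi> v \<in> fiber B b" "\<phi> (inv_into (fiber B b) \<phi> v) = v"
    by (rule inv_into_into, rule f_inv_into_f)
qed

lemma fibre_isometry_add:
  "fibre_isometry J B b \<phi> \<Longrightarrow> e \<in> fiber B b \<Longrightarrow> e' \<in> fiber B b \<Longrightarrow>
    vadd B e e' \<in> fiber B b \<and> \<phi> (vadd B e e') = (\<lambda>j. \<phi> e j + \<phi> e' j)"
  by (simp add: fibre_isometry_def)

lemma fibre_isometry_scale:
  "fibre_isometry J B b \<phi> \<Longrightarrow> e \<in> fiber B b \<Longrightarrow>
    vscale B c e \<in> fiber B b \<and> \<phi> (vscale B c e) = (\<lambda>j. c * \<phi> e j)"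
  by (simp add: fibre_isometry_def)

lemma fibre_isometry_inner:
  "fibre_isometry J B b \<phi> \<Longrightarrow> e \<in> fiber B b \<Longrightarrow> e' \<in> fiber B b \<Longrightarrow>
    vinner B e e' = l2_inner J (\<phi> e) (\<phi> e')"
  by (simp add: fibre_isometry_def)

lemma fibre_isometry_norm:
  "fibre_isometry J B b \<phi> \<Longrightarrow> e \<in> fiber B b \<Longrightarrow> Re (vinner B e e) = (l2_norm J (\<phi> e))\<^sup>2"
  by (simp add: fibre_isometry_inner l2_inner_self fibre_isometry_l2)

lemma transition_apply:
  assumes "fibre_isometry J B b \<psi>" "e \<in> fiber B b"
  shows "transition J B \<phi> \<psi> b (\<psi> e) = \<phi> e"
proof -
  have "inv_into (fiber B b) \<psi> (\<psi> e) = e"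
    using assms by (intro inv_into_f_f) (auto simp: fibre_isometry_def bij_betw_def)
  then show ?thesis
    by (simp add: transition_def fibre_isometry_l2[OF assms])
qed

lemma transition_unitary:
  assumes \<phi>: "fibre_isometry J B b \<phi>" and \<psi>: "fibre_isometry J B b \<psi>"
  shows "transition J B \<phi> \<psi> b \<in> unitaries J"
proof -
  let ?T = "transition J B \<phi> \<psi> b"
  have ex: "\<exists>e\<in>fiber B b. \<psi> e = v" if "v \<in> l2 J" for v
    using fibre_isometry_inv[OF \<psi> that] by blast
  have add: "?T (\<lambda>j. v j + w j) = (\<lambda>j. ?T v j + ?T w j)" if vw: "v \<in> l2 J" "w \<in> l2 J" for v w
  proof -
    obtain e e' where e: "e \<in> fiber B b" "\<psi> e = v" "e' \<in> fiber B b" "\<psi> e' = w"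
      using ex vw by metis
    have "?T (\<lambda>j. \<psi> e j + \<psi> e' j) = (\<lambda>j. ?T (\<psi> e) j + ?T (\<psi> e') j)"
      using fibre_isometry_add[OF \<psi> e(1,3)] fibre_isometry_add[OF \<phi> e(1,3)]
        transition_apply[OF \<psi>, of "vadd B e e'"]
      by (simp add: transition_apply[OF \<psi>] e(1,3))
    then show ?thesis
      by (simp add: e)
  qed
  have scale: "?T (\<lambda>j. c * v j) = (\<lambda>j. c * ?T v j)" if v: "v \<in> l2 J" for v c
  proof -
    obtain e where e: "e \<in> fiber B b" "\<psi> e = v"
      using ex v by metis
    have "?T (\<lambda>j. c * \<psi> e j) = (\<lambda>j. c * ?T (\<psi> e) j)"
      using fibre_isometry_scale[OF \<psi> e(1), of c] fibre_isometry_scale[OF \<phi> e(1), of c]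
        transition_apply[OF \<psi>, of "vscale B c e"]
      by (simp add: transition_apply[OF \<psi>] e(1))
    then show ?thesis
      by (simp add: e)
  qed
  have inner: "l2_inner J (?T v) (?T w) = l2_inner J v w" if vw: "v \<in> l2 J" "w \<in> l2 J" for v w
  proof -
    obtain e e' where e: "e \<in> fiber B b" "\<psi> e = v" "e' \<in> fiber B b" "\<psi> e' = w"
      using ex vw by metis
    have "l2_inner J (?T (\<psi> e)) (?T (\<psi> e')) = l2_inner J (\<psi> e) (\<psi> e')"
      using fibre_isometry_inner[OF \<psi> e(1,3)] fibre_isometry_inner[OF \<phi> e(1,3)]
      by (simp add: transition_apply[OF \<psi>] e(1,3))
    then show ?thesis
      by (simp add: e)
  qed
  have "bij_betw (\<phi> \<circ> inv_into (fiber B b) \<psi>) (l2 J) (l2 J)"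
    using \<phi> \<psi> by (intro bij_betw_trans[of _ _ "fiber B b"] bij_betw_inv_into)
      (auto simp: fibre_isometry_def)
  then have bij: "bij_betw ?T (l2 J) (l2 J)"
    by (rule bij_betw_cong[THEN iffD1, rotated]) (simp add: transition_def)
  have ext: "?T \<in> extensional (l2 J)"
    by (simp add: transition_def)
  show ?thesis
    unfolding unitaries_def using ext bij add scale inner by blast
qed

section \<open>Sheets over the members of the cover\<close>

text \<open>Throughout, \<open>\<rho>\<close> and \<open>\<sigma>\<close> are permutations of \<open>F\<close> by which sheets are relabelled: the sheet
  \<open>S l (\<rho> x)\<close> gets the label \<open>x\<close>.  Relabelled sheets are kept in all statements because the given
  labels serve to define the topology of the pushforward, while different ones are needed for finite
  propagation.\<close>

locale pushforward_atlas =
  fixes E :: "('x::metric_space, 'e) hfamily"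
    and \<pi> :: "'x \<Rightarrow> 'y::metric_space"
    and F :: "'x set" and n :: nat
    and \<Lambda> :: "'l set" and U :: "'l \<Rightarrow> 'y set"
    and S :: "'l \<Rightarrow> 'x \<Rightarrow> 'x set"
    and \<phi> :: "'l \<Rightarrow> 'e \<Rightarrow> nat \<Rightarrow> complex"
  assumes open_U: "\<And>l. l \<in> \<Lambda> \<Longrightarrow> open (U l)"
    and cover_U: "(\<Union>l\<in>\<Lambda>. U l) = UNIV"
    and atlas: "covering_atlas \<pi> F \<Lambda> U S"
    and isometry: "\<And>l x a b. \<lbrakk>l \<in> \<Lambda>; x \<in> F; a \<in> S l x; b \<in> S l x\<rbrakk> \<Longrightarrow> dist (\<pi> a) (\<pi> b) = dist a b"
    and trivial_E: "\<And>l. l \<in> \<Lambda> \<Longrightarrow> unitary_trivialization {..<n} E (\<pi> -` U l) (\<phi> l)"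
    and equicontinuous: "\<And>l m. \<lbrakk>l \<in> \<Lambda>; m \<in> \<Lambda>\<rbrakk> \<Longrightarrow>
      equicontinuous_family (F \<times> F) (\<lambda>(x, y). S l x \<inter> S m y) (op_dist {..<n})
        (\<lambda>_. transition {..<n} E (\<phi> l) (\<phi> m))"
begin

definition lift :: "'l \<Rightarrow> ('x \<Rightarrow> 'x) \<Rightarrow> 'y \<Rightarrow> 'x \<Rightarrow> 'x" where
  "lift l \<rho> y x = inv_into (S l (\<rho> x)) \<pi> y"

lemma sheets_over:
  assumes "l \<in> \<Lambda>"
  shows "disjoint_family_on (S l) F" "(\<Union>x\<in>F. S l x) = \<pi> -` U l"
    and "x \<in> F \<Longrightarrow> inj_on \<pi> (S l x)" "x \<in> F \<Longrightarrow> \<pi> ` S l x = U l"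
proof -
  have *: "covering_trivialization \<pi> F (U l) (S l)"
    using atlas assms by (auto simp: covering_atlas_def)
  then show "disjoint_family_on (S l) F" "(\<Union>x\<in>F. S l x) = \<pi> -` U l"
    by (auto simp: covering_trivialization_def)
  assume "x \<in> F"
  then obtain g where "homeomorphism (S l x) (U l) \<pi> g"
    using * by (auto simp: covering_trivialization_def)
  then show "inj_on \<pi> (S l x)" "\<pi> ` S l x = U l"
    by (auto simp: homeomorphism_def intro: inj_on_inverseI)
qed

lemma sheet_unique:
  "l \<in> \<Lambda> \<Longrightarrow> x \<in> F \<Longrightarrow> x' \<in> F \<Longrightarrow> a \<in> S l x \<Longrightarrow> a \<in> S l x' \<Longrightarrow> x = x'"
  using sheets_over(1)[of l] unfolding disjoint_family_on_def by blast

lemma lift_in_sheet: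
  assumes "l \<in> \<Lambda>" "bij_betw \<rho> F F" "y \<in> U l" "x \<in> F"
  shows "lift l \<rho> y x \<in> S l (\<rho> x)" "\<pi> (lift l \<rho> y x) = y"
proof -
  have "\<rho> x \<in> F"
    using assms(2,4) by (auto simp: bij_betw_def)
  then have "y \<in> \<pi> ` S l (\<rho> x)"
    using sheets_over(4)[OF assms(1)] assms(3) by blast
  then show "lift l \<rho> y x \<in> S l (\<rho> x)" "\<pi> (lift l \<rho> y x) = y"
    unfolding lift_def by (rule inv_into_into, rule f_inv_into_f)
qed

lemma lift_eqI:
  assumes "l \<in> \<Lambda>" "bij_betw \<rho> F F" "x \<in> F" "a \<in> S l (\<rho> x)" "\<pi> a = y"
  shows "lift l \<rho> y x = a"
  unfolding lift_def
  by (rule inv_into_f_eq[OF sheets_over(3)[OF assms(1) bij_betwE[OF assms(2), rule_format, OF assms(3)]] assms(4,5)])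

lemma bij_betw_lift:
  assumes l: "l \<in> \<Lambda>" and \<rho>: "bij_betw \<rho> F F" and y: "y \<in> U l"
  shows "bij_betw (lift l \<rho> y) F (\<pi> -` {y})"
proof (rule bij_betw_imageI)
  have \<rho>F: "\<rho> x \<in> F" if "x \<in> F" for x
    using \<rho> that by (auto simp: bij_betw_def)
  show "inj_on (lift l \<rho> y) F"
  proof (rule inj_onI)
    fix x x'
    assume x: "x \<in> F" "x' \<in> F" "lift l \<rho> y x = lift l \<rho> y x'"
    then have "\<rho> x = \<rho> x'"
      using lift_in_sheet(1)[OF l \<rho> y] sheet_unique[OF l] \<rho>F by metis
    then show "x = x'"
      using \<rho> x by (auto simp: bij_betw_def dest: inj_onD)
  qed
  show "lift l \<rho> y ` F = \<pi> -` {y}"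
  proof
    show "lift l \<rho> y ` F \<subseteq> \<pi> -` {y}"
      using lift_in_sheet(2)[OF l \<rho> y] by auto
    show "\<pi> -` {y} \<subseteq> lift l \<rho> y ` F"
    proof
      fix a
      assume a: "a \<in> \<pi> -` {y}"
      then obtain w where w: "w \<in> F" "a \<in> S l w"
        using sheets_over(2)[OF l] y by blast
      then have "w \<in> \<rho> ` F"
        using bij_betw_imp_surj_on[OF \<rho>] by simp
      then obtain x where "x \<in> F" "\<rho> x = w"
        by (auto simp only: image_iff)
      then show "a \<in> lift l \<rho> y ` F"
        using lift_eqI[OF l \<rho>, of x a y] w a by blast
    qed
  qed
qed

text \<open>The sheet over \<open>U m\<close>, relabelled by \<open>\<sigma>\<close>, that contains the point over \<open>y\<close> of the sheet over
  \<open>U l\<close> with new label \<open>x\<close>.\<close>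

definition relabel :: "'l \<Rightarrow> ('x \<Rightarrow> 'x) \<Rightarrow> 'l \<Rightarrow> ('x \<Rightarrow> 'x) \<Rightarrow> 'y \<Rightarrow> 'x \<Rightarrow> 'x" where
  "relabel l \<rho> m \<sigma> y x = inv_into F (lift m \<sigma> y) (lift l \<rho> y x)"

context
  fixes l m :: 'l and \<rho> \<sigma> :: "'x \<Rightarrow> 'x"
  assumes l: "l \<in> \<Lambda>" and m: "m \<in> \<Lambda>" and \<rho>: "bij_betw \<rho> F F" and \<sigma>: "bij_betw \<sigma> F F"
begin

lemma bij_betw_relabel:
  assumes y: "y \<in> U l \<inter> U m"
  shows "bij_betw (relabel l \<rho> m \<sigma> y) F F"
proof -
  have "bij_betw (inv_into F (lift m \<sigma> y) \<circ> lift l \<rho> y) F F"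
    using y by (intro bij_betw_trans[OF bij_betw_lift[OF l \<rho>]] bij_betw_inv_into[OF bij_betw_lift[OF m \<sigma>]]) auto
  then show ?thesis
    by (rule bij_betw_cong[THEN iffD1, rotated]) (simp add: relabel_def)
qed

lemma lift_relabel:
  assumes y: "y \<in> U l \<inter> U m" and x: "x \<in> F"
  shows "lift m \<sigma> y (relabel l \<rho> m \<sigma> y x) = lift l \<rho> y x"
proof -
  have "lift l \<rho> y x \<in> lift m \<sigma> y ` F"
    using bij_betw_lift[OF l \<rho>, of y] bij_betw_lift[OF m \<sigma>, of y] y x by (auto simp: bij_betw_def)
  then show ?thesis
    unfolding relabel_def by (rule f_inv_into_f)
qed

lemma relabel_in: "y \<in> U l \<inter> U m \<Longrightarrow> x \<in> F \<Longrightarrow> relabel l \<rho> m \<sigma> y x \<in> F"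
  using bij_betw_relabel by (auto simp: bij_betw_def)

lemma sheet_transition_relabel:
  assumes y: "y \<in> U l \<inter> U m" and x: "x \<in> F"
  shows "sheet_transition \<pi> F (S l) (S m) y (\<rho> x) = \<sigma> (relabel l \<rho> m \<sigma> y x)"
proof -
  have F: "\<rho> x \<in> F" "\<sigma> (relabel l \<rho> m \<sigma> y x) \<in> F"
    using \<rho> \<sigma> x relabel_in[OF y x] by (auto simp: bij_betw_def)
  have "lift l \<rho> y x \<in> S m (\<sigma> (relabel l \<rho> m \<sigma> y x))"
    using lift_in_sheet(1)[OF m \<sigma> _ relabel_in[OF y x], of y] y lift_relabel[OF y x] by simp
  then have "(THE x'. x' \<in> F \<and> lift l \<rho> y x \<in> S m x') = \<sigma> (relabel l \<rho> m \<sigma> y x)"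
    using F(2) sheet_unique[OF m] by (intro the_equality) auto
  then show ?thesis
    using F(1) by (simp add: sheet_transition_def lift_def)
qed

lemma relabel_locally_constant:
  assumes y: "y \<in> U l \<inter> U m"
  obtains W where "openin (top_of_set (U l \<inter> U m)) W" "y \<in> W"
    "\<And>z x. z \<in> W \<Longrightarrow> x \<in> F \<Longrightarrow> relabel l \<rho> m \<sigma> z x = relabel l \<rho> m \<sigma> y x"
proof
  let ?t = "sheet_transition \<pi> F (S l) (S m)"
  let ?W = "{z \<in> topspace (top_of_set (U l \<inter> U m)). ?t z \<in> {?t y}}"
  have "continuous_map (top_of_set (U l \<inter> U m)) (discrete_topology UNIV) ?t"
    using atlas l m by (auto simp: covering_atlas_def)
  then show "openin (top_of_set (U l \<inter> U m)) ?W"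
    by (rule openin_continuous_map_preimage) simp
  show "y \<in> ?W"
    using y by simp
  fix z x
  assume "z \<in> ?W" and x: "x \<in> F"
  then have z: "z \<in> U l \<inter> U m" "?t z (\<rho> x) = ?t y (\<rho> x)"
    by auto
  then have "\<sigma> (relabel l \<rho> m \<sigma> z x) = \<sigma> (relabel l \<rho> m \<sigma> y x)"
    using sheet_transition_relabel[OF _ x] y by metis
  then show "relabel l \<rho> m \<sigma> z x = relabel l \<rho> m \<sigma> y x"
    using \<sigma> relabel_in[OF y x] relabel_in[OF z(1) x] by (auto simp: bij_betw_def dest: inj_onD)
qed

end

section \<open>The fibres of the pushforward\<close>

abbreviation J :: "('x \<times> nat) set" where
  "J \<equiv> F \<times> {..<n}"

abbreviation P :: "('y, 'y \<times> ('x \<Rightarrow> 'e)) hfamily" where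
  "P \<equiv> pushforward n E \<pi> F \<Lambda> U S \<phi>"

abbreviation chart :: "'l \<Rightarrow> ('x \<Rightarrow> 'x) \<Rightarrow> 'y \<times> ('x \<Rightarrow> 'e) \<Rightarrow> 'x \<times> nat \<Rightarrow> complex" where
  "chart l \<rho> \<equiv> induced_trivialization \<pi> F (\<lambda>x. S l (\<rho> x)) (\<phi> l)"

lemma chart_apply:
  "chart l \<rho> (y, s) (x, i) = (if x \<in> F then \<phi> l (s (lift l \<rho> y x)) i else 0)"
  by (simp add: induced_trivialization_def lift_def)

lemma fibre_isometry_E: "l \<in> \<Lambda> \<Longrightarrow> \<pi> a \<in> U l \<Longrightarrow> fibre_isometry {..<n} E a (\<phi> l)"
  using unitary_trivialization_imp_fibre_isometry[OF trivial_E] by simp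

context
  fixes l :: 'l and \<rho> :: "'x \<Rightarrow> 'x" and y :: 'y
  assumes l: "l \<in> \<Lambda>" and \<rho>: "bij_betw \<rho> F F" and y: "y \<in> U l"
begin

lemma fibre_isometry_lift: "x \<in> F \<Longrightarrow> fibre_isometry {..<n} E (lift l \<rho> y x) (\<phi> l)"
  by (rule fibre_isometry_E[OF l]) (simp add: lift_in_sheet(2)[OF l \<rho> y] y)

lemma section_at_lift:
  "s \<in> (\<Pi>\<^sub>E x\<in>\<pi> -` {y}. fiber E x) \<Longrightarrow> x \<in> F \<Longrightarrow> s (lift l \<rho> y x) \<in> fiber E (lift l \<rho> y x)"
  using PiE_mem[of s "\<pi> -` {y}" "fiber E" "lift l \<rho> y x"] lift_in_sheet(2)[OF l \<rho> y] by simp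

lemma chart_slice: "x \<in> F \<Longrightarrow> (\<lambda>i. chart l \<rho> (y, s) (x, i)) = \<phi> l (s (lift l \<rho> y x))"
  by (simp add: chart_apply)

lemma pushforward_space_iff_chart_l2:
  assumes s: "s \<in> (\<Pi>\<^sub>E x\<in>\<pi> -` {y}. fiber E x)"
  shows "(y, s) \<in> pushforward_space E \<pi> \<longleftrightarrow> chart l \<rho> (y, s) \<in> l2 J"
proof -
  have "(y, s) \<in> pushforward_space E \<pi> \<longleftrightarrow>
      (\<lambda>x. Re (vinner E (s x) (s x))) summable_on \<pi> -` {y}"
    by (simp only: pushforward_space_def mem_Collect_eq prod.case s simp_thms)
  also have "\<dots> \<longleftrightarrow> (\<lambda>x. Re (vinner E (s (lift l \<rho> y x)) (s (lift l \<rho> y x)))) summable_on F"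
    by (rule summable_on_reindex_bij_betw[OF bij_betw_lift[OF l \<rho> y], symmetric])
  also have "\<dots> \<longleftrightarrow> (\<lambda>x. (l2_norm {..<n} (\<lambda>i. chart l \<rho> (y, s) (x, i)))\<^sup>2) summable_on F"
    by (rule summable_on_cong)
      (simp add: chart_slice fibre_isometry_norm[OF fibre_isometry_lift section_at_lift[OF s]])
  also have "\<dots> \<longleftrightarrow> chart l \<rho> (y, s) \<in> l2 J"
  proof -
    have "chart l \<rho> (y, s) (x, i) = 0" if "(x, i) \<notin> J" for x i
      using that l2_outside[OF fibre_isometry_l2[OF fibre_isometry_lift section_at_lift[OF s]]]
      by (auto simp: chart_apply)
    then show ?thesis
      by (auto simp: l2_Times_finite)
  qed
  finally show ?thesis .
qed

end

lemma topspace_P: "topspace (total P) = pushforward_space E \<pi>"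
proof
  show "topspace (total P) \<subseteq> pushforward_space E \<pi>"
    unfolding pushforward_def hfamily.simps topology_generated_by_topspace by blast
  show "pushforward_space E \<pi> \<subseteq> topspace (total P)"
  proof
    fix p
    assume p: "p \<in> pushforward_space E \<pi>"
    obtain y s where ys: "p = (y, s)"
      by (cases p)
    obtain l where l: "l \<in> \<Lambda>" "y \<in> U l"
      using cover_U by blast
    have "s \<in> (\<Pi>\<^sub>E x\<in>\<pi> -` {y}. fiber E x)"
      using p unfolding ys pushforward_space_def by blast
    then have "chart l (\<lambda>x. x) p \<in> l2 J"
      using pushforward_space_iff_chart_l2[OF l(1) bij_betw_id[unfolded id_def] l(2)] p ys by simp
    then have "p \<in> {p \<in> pushforward_space E \<pi>. fst p \<in> U l \<and>
        (fst p, chart l (\<lambda>x. x) p) \<in> topspace (prod_topology (top_of_set (U l)) (l2_topology J))}"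
      using p ys l by simp
    then show "p \<in> topspace (total P)"
      unfolding pushforward_def hfamily.simps topology_generated_by_topspace
      using l(1) openin_topspace by blast
  qed
qed

lemma fiber_P: "fiber P y = {p \<in> pushforward_space E \<pi>. fst p = y}"
  unfolding over_def topspace_P by (simp add: pushforward_def)

lemma fiber_P_iff: "l \<in> \<Lambda> \<Longrightarrow> bij_betw \<rho> F F \<Longrightarrow> y \<in> U l \<Longrightarrow>
  p \<in> fiber P y \<longleftrightarrow> (\<exists>s. p = (y, s) \<and> s \<in> (\<Pi>\<^sub>E x\<in>\<pi> -` {y}. fiber E x) \<and> chart l \<rho> (y, s) \<in> l2 J)"
  unfolding fiber_P using pushforward_space_iff_chart_l2[of l \<rho> y]
  by (cases p) (auto simp: pushforward_space_def)

text \<open>The points over \<open>y\<close> are in bijection with \<open>F\<close>, so the coordinates of a section over \<open>\<pi> -` {y}\<close>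
  can be prescribed independently at each of these points, up to square summability.\<close>

lemma bij_betw_chart:
  assumes l: "l \<in> \<Lambda>" and \<rho>: "bij_betw \<rho> F F" and y: "y \<in> U l"
  shows "bij_betw (chart l \<rho>) (fiber P y) (l2 J)"
proof (rule bij_betw_imageI)
  note iff = fiber_P_iff[OF l \<rho> y] and iso = fibre_isometry_lift[OF l \<rho> y]
  have surj_lift: "\<exists>x\<in>F. a = lift l \<rho> y x" if "a \<in> \<pi> -` {y}" for a
    using bij_betw_lift[OF l \<rho> y] that by (auto simp: bij_betw_def)
  show "inj_on (chart l \<rho>) (fiber P y)"
  proof (rule inj_onI)
    fix p p'
    assume "p \<in> fiber P y" "p' \<in> fiber P y" and eq: "chart l \<rho> p = chart l \<rho> p'"
    then obtain s s' where s: "p = (y, s)" "s \<in> (\<Pi>\<^sub>E x\<in>\<pi> -` {y}. fiber E x)"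
      and s': "p' = (y, s')" "s' \<in> (\<Pi>\<^sub>E x\<in>\<pi> -` {y}. fiber E x)"
      unfolding iff by blast
    have "s a = s' a" if a: "a \<in> \<pi> -` {y}" for a
    proof -
      obtain x where x: "x \<in> F" "a = lift l \<rho> y x"
        using surj_lift[OF a] by blast
      have "\<phi> l (s a) = \<phi> l (s' a)"
        using eq chart_slice[OF l \<rho> y x(1), of s] chart_slice[OF l \<rho> y x(1), of s'] s(1) s'(1) x(2)
        by simp
      then show ?thesis
        using fibre_isometry_inj[OF iso[OF x(1)]] section_at_lift[OF l \<rho> y _ x(1)] s s' x(2) by blast
    qed
    then show "p = p'"
      using PiE_ext[OF s(2) s'(2)] s(1) s'(1) by simp
  qed
  show "chart l \<rho> ` fiber P y = l2 J"
  proof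
    show "chart l \<rho> ` fiber P y \<subseteq> l2 J"
      by (rule image_subsetI) (auto simp only: iff)
    show "l2 J \<subseteq> chart l \<rho> ` fiber P y"
    proof
      fix v
      assume v: "v \<in> l2 J"
      define x where "x = inv_into F (lift l \<rho> y)"
      have x: "x a \<in> F" "lift l \<rho> y (x a) = a" if "a \<in> \<pi> -` {y}" for a
        using bij_betw_lift[OF l \<rho> y] that unfolding x_def bij_betw_def
        by (metis inv_into_into, metis f_inv_into_f)
      have x_lift: "x (lift l \<rho> y w) = w" if "w \<in> F" for w
        using bij_betw_lift[OF l \<rho> y] that unfolding x_def bij_betw_def by (metis inv_into_f_f)
      define s where "s = (\<lambda>a\<in>\<pi> -` {y}. inv_into (fiber E a) (\<phi> l) (\<lambda>i. v (x a, i)))"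
      have vx: "(\<lambda>i. v (w, i)) \<in> l2 {..<n}" for w
        using l2_slice[OF _ v] by simp
      have "s \<in> (\<Pi>\<^sub>E a\<in>\<pi> -` {y}. fiber E a)"
        unfolding s_def using y by (intro restrict_PiE[THEN iffD2] Pi_I fibre_isometry_inv(1)[OF fibre_isometry_E[OF l] vx]) auto
      moreover have "chart l \<rho> (y, s) = v"
      proof
        fix p :: "'x \<times> nat"
        obtain w i where p: "p = (w, i)"
          by (cases p)
        show "chart l \<rho> (y, s) p = v p"
        proof (cases "w \<in> F")
          case True
          then have "lift l \<rho> y w \<in> \<pi> -` {y}"
            using lift_in_sheet(2)[OF l \<rho> y] by simp
          then have "\<phi> l (s (lift l \<rho> y w)) = (\<lambda>i. v (w, i))"
            unfolding s_def using x_lift[OF True] fibre_isometry_inv(2)[OF iso[OF True] vx] by simp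
          then show ?thesis
            using True p by (simp add: chart_apply)
        next
          case False
          then show ?thesis
            using p l2_outside[OF v] by (simp add: chart_apply)
        qed
      qed
      ultimately show "v \<in> chart l \<rho> ` fiber P y"
        using v unfolding image_iff Bex_def iff by metis
    qed
  qed
qed

text \<open>Under the identification of \<open>F\<close> with \<open>\<pi> -` {y}\<close>, the chart is the orthogonal direct sum of
  the trivializations of the fibres of \<open>E\<close> over \<open>\<pi> -` {y}\<close>.\<close>

lemma fibre_isometry_chart:
  assumes l: "l \<in> \<Lambda>" and \<rho>: "bij_betw \<rho> F F" and y: "y \<in> U l"
  shows "fibre_isometry J P y (chart l \<rho>)"
  unfolding fibre_isometry_def
proof (intro conjI ballI allI)
  show "bij_betw (chart l \<rho>) (fiber P y) (l2 J)"
    by (rule bij_betw_chart[OF assms])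
  note iff = fiber_P_iff[OF assms]
  note iso = fibre_isometry_lift[OF assms] and sec = section_at_lift[OF assms]
  have liftD: "lift l \<rho> y x \<in> \<pi> -` {y}" if "x \<in> F" for x
    using lift_in_sheet(2)[OF assms that] by simp
  have isoE: "fibre_isometry {..<n} E a (\<phi> l)" if "\<pi> a = y" for a
    using fibre_isometry_E[OF l] that y by simp
  fix p p'
  assume p: "p \<in> fiber P y" and p': "p' \<in> fiber P y"
  obtain s where s: "p = (y, s)" "s \<in> (\<Pi>\<^sub>E x\<in>\<pi> -` {y}. fiber E x)" "chart l \<rho> p \<in> l2 J"
    using p iff by auto
  obtain s' where s': "p' = (y, s')" "s' \<in> (\<Pi>\<^sub>E x\<in>\<pi> -` {y}. fiber E x)" "chart l \<rho> p' \<in> l2 J"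
    using p' iff by auto
  let ?a = "\<lambda>x\<in>\<pi> -` {y}. vadd E (s x) (s' x)"
  have add: "vadd P p p' = (y, ?a)"
    by (simp add: pushforward_def s(1) s'(1))
  have cadd: "chart l \<rho> (y, ?a) = (\<lambda>j. chart l \<rho> p j + chart l \<rho> p' j)"
  proof
    fix j :: "'x \<times> nat"
    obtain x i where j: "j = (x, i)"
      by (cases j)
    show "chart l \<rho> (y, ?a) j = chart l \<rho> p j + chart l \<rho> p' j"
    proof (cases "x \<in> F")
      case True
      show ?thesis
        using fibre_isometry_add[OF iso[OF True] sec[OF s(2) True] sec[OF s'(2) True]] liftD[OF True] True
        by (simp add: j s(1) s'(1) chart_apply)
    qed (simp add: j s(1) s'(1) chart_apply)
  qed
  have "?a \<in> (\<Pi>\<^sub>E x\<in>\<pi> -` {y}. fiber E x)"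
    using fibre_isometry_add[OF isoE] PiE_mem[OF s(2)] PiE_mem[OF s'(2)] by auto
  then show "vadd P p p' \<in> fiber P y"
    unfolding iff add using cadd l2_add[OF s(3) s'(3)] by simp
  show "chart l \<rho> (vadd P p p') = (\<lambda>j. chart l \<rho> p j + chart l \<rho> p' j)"
    unfolding add by (rule cadd)
  {
    fix c
    let ?c = "\<lambda>x\<in>\<pi> -` {y}. vscale E c (s x)"
    have scale: "vscale P c p = (y, ?c)"
      by (simp add: pushforward_def s(1))
    have cscale: "chart l \<rho> (y, ?c) = (\<lambda>j. c * chart l \<rho> p j)"
    proof
      fix j :: "'x \<times> nat"
      obtain x i where j: "j = (x, i)"
        by (cases j)
      show "chart l \<rho> (y, ?c) j = c * chart l \<rho> p j"
      proof (cases "x \<in> F")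
        case True
        show ?thesis
          using fibre_isometry_scale[OF iso[OF True] sec[OF s(2) True], of c] liftD[OF True] True
          by (simp add: j s(1) chart_apply)
      qed (simp add: j s(1) chart_apply)
    qed
    have "?c \<in> (\<Pi>\<^sub>E x\<in>\<pi> -` {y}. fiber E x)"
      using fibre_isometry_scale[OF isoE] PiE_mem[OF s(2)] by auto
    then show "vscale P c p \<in> fiber P y"
      unfolding iff scale using cscale l2_scale[OF s(3)] by simp
    show "chart l \<rho> (vscale P c p) = (\<lambda>j. c * chart l \<rho> p j)"
      unfolding scale by (rule cscale)
  }
  have "vinner P p p' = (\<Sum>\<^sub>\<infinity>a\<in>\<pi> -` {y}. vinner E (s a) (s' a))"
    by (simp add: pushforward_def s(1) s'(1))
  also have "\<dots> = (\<Sum>\<^sub>\<infinity>x\<in>F. vinner E (s (lift l \<rho> y x)) (s' (lift l \<rho> y x)))"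
    by (rule infsum_reindex_bij_betw[OF bij_betw_lift[OF assms], symmetric])
  also have "\<dots> = (\<Sum>\<^sub>\<infinity>x\<in>F. l2_inner {..<n} (\<lambda>i. chart l \<rho> p (x, i)) (\<lambda>i. chart l \<rho> p' (x, i)))"
    by (rule infsum_cong)
      (simp add: s(1) s'(1) chart_slice[OF assms] fibre_isometry_inner[OF iso sec[OF s(2)] sec[OF s'(2)]])
  also have "\<dots> = l2_inner J (chart l \<rho> p) (chart l \<rho> p')"
    by (rule l2_inner_Times_finite[OF _ s(3) s'(3), symmetric]) simp
  finally show "vinner P p p' = l2_inner J (chart l \<rho> p) (chart l \<rho> p')" .
qed


section \<open>Transition functions of the pushforward\<close>

lemma fibre_isometry_E_transition:
  assumes "l \<in> \<Lambda>" "m \<in> \<Lambda>" "\<pi> a \<in> U l" "\<pi> a \<in> U m"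
  shows "transition {..<n} E (\<phi> l) (\<phi> m) a \<in> unitaries {..<n}"
  by (intro transition_unitary fibre_isometry_E assms)

lemma dist_lift:
  assumes "l \<in> \<Lambda>" "bij_betw \<rho> F F" "y \<in> U l" "z \<in> U l" "x \<in> F"
  shows "dist (lift l \<rho> y x) (lift l \<rho> z x) = dist y z"
proof -
  have "\<rho> x \<in> F"
    using assms(2,5) by (auto simp: bij_betw_def)
  then show ?thesis
    using isometry[OF assms(1), of "\<rho> x" "lift l \<rho> y x" "lift l \<rho> z x"]
      lift_in_sheet[OF assms(1,2,3,5)] lift_in_sheet[OF assms(1,2,4,5)] by simp
qed

context
  fixes l m :: 'l and \<rho> \<sigma> :: "'x \<Rightarrow> 'x"
  assumes l: "l \<in> \<Lambda>" and m: "m \<in> \<Lambda>" and \<rho>: "bij_betw \<rho> F F" and \<sigma>: "bij_betw \<sigma> F F"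
begin

abbreviation T :: "'y \<Rightarrow> ('x \<times> nat) operator" where
  "T \<equiv> transition J P (chart l \<rho>) (chart m \<sigma>)"

abbreviation G :: "'x \<Rightarrow> nat operator" where
  "G \<equiv> transition {..<n} E (\<phi> l) (\<phi> m)"

lemma transition_P_unitary: "y \<in> U l \<inter> U m \<Longrightarrow> T y \<in> unitaries J"
  using fibre_isometry_chart[OF l \<rho>] fibre_isometry_chart[OF m \<sigma>] by (intro transition_unitary) auto

text \<open>A transition function of the pushforward is a permutation matrix, given by the change of
  labels, with unitary \<open>n \<times> n\<close> blocks, given by the transition functions of \<open>E\<close>.\<close>

lemma transition_P_slice:
  assumes y: "y \<in> U l \<inter> U m" and v: "v \<in> l2 J" and x: "x \<in> F"
  shows "(\<lambda>i. T y v (x, i)) = G (lift l \<rho> y x) (\<lambda>i. v (relabel l \<rho> m \<sigma> y x, i))"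
proof -
  have yl: "y \<in> U l" and ym: "y \<in> U m"
    using y by auto
  note iso = fibre_isometry_chart[OF m \<sigma> ym]
  obtain p where p: "p \<in> fiber P y" "chart m \<sigma> p = v"
    using fibre_isometry_inv[OF iso v] by blast
  obtain s where s: "p = (y, s)" "s \<in> (\<Pi>\<^sub>E x\<in>\<pi> -` {y}. fiber E x)"
    using p(1) fiber_P_iff[OF m \<sigma> ym] by auto
  have rx: "relabel l \<rho> m \<sigma> y x \<in> F"
    by (rule relabel_in[OF l m \<rho> \<sigma> y x])
  have "T y v = chart l \<rho> p"
    using transition_apply[OF iso p(1)] p(2) by simp
  then have "(\<lambda>i. T y v (x, i)) = \<phi> l (s (lift l \<rho> y x))"
    using chart_slice[OF l \<rho> yl x] s(1) by simp
  also have "\<dots> = G (lift l \<rho> y x) (\<phi> m (s (lift l \<rho> y x)))"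
    using transition_apply[OF fibre_isometry_E[OF m] section_at_lift[OF l \<rho> yl s(2) x]]
      lift_in_sheet(2)[OF l \<rho> yl x] ym by simp
  also have "\<phi> m (s (lift l \<rho> y x)) = (\<lambda>i. v (relabel l \<rho> m \<sigma> y x, i))"
    using chart_slice[OF m \<sigma> ym rx, of s] lift_relabel[OF l m \<rho> \<sigma> y x] p(2) s(1) by simp
  finally show ?thesis .
qed

text \<open>Near \<open>y\<close> the change of labels is constant, so \<open>T z - T y\<close> has the same block structure as
  \<open>T y\<close>.  Its norm is the supremum over all, possibly infinitely many, blocks, and this is where
  equicontinuity is needed; since the sheets are isometric to \<open>U l\<close>, one \<open>\<delta>\<close> serves all of them.\<close>

lemma continuous_transition_P:
  "continuous_map (top_of_set (U l \<inter> U m)) (unitary_topology J) T"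
  unfolding continuous_map_into_unitary_topology
proof (intro conjI ballI allI impI)
  show "T ` topspace (top_of_set (U l \<inter> U m)) \<subseteq> unitaries J"
    using transition_P_unitary by auto
  fix y and \<epsilon> :: real
  assume "y \<in> topspace (top_of_set (U l \<inter> U m))" and \<epsilon>: "\<epsilon> > 0"
  then have y: "y \<in> U l \<inter> U m"
    by simp
  have "\<epsilon> / 2 > 0"
    using \<epsilon> by simp
  then obtain \<delta> where \<delta>: "\<delta> > 0" and \<delta>G: "\<forall>i\<in>F \<times> F. \<forall>a\<in>(case i of (x, y) \<Rightarrow> S l x \<inter> S m y).
      \<forall>b\<in>(case i of (x, y) \<Rightarrow> S l x \<inter> S m y). dist a b < \<delta> \<longrightarrow> op_dist {..<n} (G a) (G b) < \<epsilon> / 2"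
    using equicontinuous[OF l m] unfolding equicontinuous_family_def by meson
  obtain W where W: "openin (top_of_set (U l \<inter> U m)) W" "y \<in> W"
    "\<And>z x. z \<in> W \<Longrightarrow> x \<in> F \<Longrightarrow> relabel l \<rho> m \<sigma> z x = relabel l \<rho> m \<sigma> y x"
    using relabel_locally_constant[OF l m \<rho> \<sigma> y] by metis
  have "op_dist J (T y) (T z) < \<epsilon>" if z: "z \<in> W" and d: "dist y z < \<delta>" for z
  proof -
    have zU: "z \<in> U l \<inter> U m"
      using openin_subset[OF W(1)] z by auto
    let ?r = "relabel l \<rho> m \<sigma> y"
    have block: "op_dist {..<n} (G (lift l \<rho> y x)) (G (lift l \<rho> z x)) \<le> \<epsilon> / 2" if x: "x \<in> F" for x
    proof -
      have in_sheets: "lift l \<rho> w x \<in> S l (\<rho> x) \<inter> S m (\<sigma> (?r x))" if w: "w \<in> W" for w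
      proof -
        have wU: "w \<in> U l \<inter> U m"
          using openin_subset[OF W(1)] w by auto
        have "lift m \<sigma> w (?r x) \<in> S m (\<sigma> (?r x))"
          using lift_in_sheet(1)[OF m \<sigma> _ relabel_in[OF l m \<rho> \<sigma> y x], of w] wU by blast
        then show ?thesis
          using lift_in_sheet(1)[OF l \<rho> _ x, of w] lift_relabel[OF l m \<rho> \<sigma> wU x] W(3)[OF w x] wU
          by simp
      qed
      have "(\<rho> x, \<sigma> (?r x)) \<in> F \<times> F"
        using \<rho> \<sigma> x relabel_in[OF l m \<rho> \<sigma> y x] by (auto simp: bij_betw_def)
      moreover have "dist (lift l \<rho> y x) (lift l \<rho> z x) < \<delta>"
        using dist_lift[OF l \<rho> _ _ x, of y z] y zU d by simp
      ultimately have "op_dist {..<n} (G (lift l \<rho> y x)) (G (lift l \<rho> z x)) < \<epsilon> / 2"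
        using \<delta>G in_sheets[OF W(2)] in_sheets[OF z] by blast
      then show ?thesis
        by simp
    qed
    have "op_dist J (T y) (T z) \<le> \<epsilon> / 2"
    proof (rule op_dist_le)
      fix v
      assume v: "v \<in> l2 J"
      let ?d = "\<lambda>p. T y v p - T z v p"
      have d: "?d \<in> l2 J"
        using l2_diff[OF unitary_l2[OF transition_P_unitary[OF y] v] unitary_l2[OF transition_P_unitary[OF zU] v]] .
      have slice: "(l2_norm {..<n} (\<lambda>i. ?d (x, i)))\<^sup>2 \<le> (\<epsilon> / 2)\<^sup>2 * (l2_norm {..<n} (\<lambda>i. v (?r x, i)))\<^sup>2"
        if x: "x \<in> F" for x
      proof -
        let ?v = "\<lambda>i. v (?r x, i)"
        have v': "?v \<in> l2 {..<n}"
          using l2_slice[OF _ v] by simp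
        have GU: "G (lift l \<rho> w x) \<in> unitaries {..<n}" if "w \<in> U l \<inter> U m" for w
          using that lift_in_sheet(2)[OF l \<rho> _ x] by (intro fibre_isometry_E_transition l m) auto
        have "(\<lambda>i. ?d (x, i)) = (\<lambda>i. G (lift l \<rho> y x) ?v i - G (lift l \<rho> z x) ?v i)"
          using transition_P_slice[OF y v x] transition_P_slice[OF zU v x] W(3)[OF z x]
          by (simp add: fun_eq_iff)
        then have "l2_norm {..<n} (\<lambda>i. ?d (x, i)) =
            l2_dist {..<n} (G (lift l \<rho> y x) ?v) (G (lift l \<rho> z x) ?v)"
          by (simp add: l2_dist_def)
        also have "\<dots> \<le> op_dist {..<n} (G (lift l \<rho> y x)) (G (lift l \<rho> z x)) * l2_norm {..<n} ?v"
          by (rule op_dist_bound[OF GU[OF y] GU[OF zU] v'])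
        also have "\<dots> \<le> \<epsilon> / 2 * l2_norm {..<n} ?v"
          by (rule mult_right_mono[OF block[OF x] l2_norm_nonneg])
        finally show ?thesis
          unfolding power_mult_distrib[symmetric] by (rule power_mono[OF _ l2_norm_nonneg])
      qed
      have bij: "bij_betw ?r F F"
        by (rule bij_betw_relabel[OF l m \<rho> \<sigma> y])
      have summable: "(\<lambda>x. (l2_norm {..<n} (\<lambda>i. f (x, i)))\<^sup>2) summable_on F" if "f \<in> l2 J" for f
        using that by (simp add: l2_Times_finite)
      have "(l2_norm J ?d)\<^sup>2 = (\<Sum>\<^sub>\<infinity>x\<in>F. (l2_norm {..<n} (\<lambda>i. ?d (x, i)))\<^sup>2)"
        by (rule l2_norm_Times_finite[OF _ d]) simp
      also have "\<dots> \<le> (\<Sum>\<^sub>\<infinity>x\<in>F. (\<epsilon> / 2)\<^sup>2 * (l2_norm {..<n} (\<lambda>i. v (?r x, i)))\<^sup>2)"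
      proof (rule infsum_mono[OF summable[OF d] _ slice])
        have "(\<lambda>x. (l2_norm {..<n} (\<lambda>i. v (?r x, i)))\<^sup>2) summable_on F"
          using summable_on_reindex_bij_betw[OF bij, of "\<lambda>x. (l2_norm {..<n} (\<lambda>i. v (x, i)))\<^sup>2"]
            summable[OF v] by simp
        then show "(\<lambda>x. (\<epsilon> / 2)\<^sup>2 * (l2_norm {..<n} (\<lambda>i. v (?r x, i)))\<^sup>2) summable_on F"
          by (rule summable_on_cmult_right)
      qed
      also have "\<dots> = (\<epsilon> / 2)\<^sup>2 * (\<Sum>\<^sub>\<infinity>x\<in>F. (l2_norm {..<n} (\<lambda>i. v (?r x, i)))\<^sup>2)"
        by (rule infsum_cmult_right')
      also have "(\<Sum>\<^sub>\<infinity>x\<in>F. (l2_norm {..<n} (\<lambda>i. v (?r x, i)))\<^sup>2) =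
          (\<Sum>\<^sub>\<infinity>x\<in>F. (l2_norm {..<n} (\<lambda>i. v (x, i)))\<^sup>2)"
        by (rule infsum_reindex_bij_betw[OF bij])
      also have "\<dots> = (l2_norm J v)\<^sup>2"
        by (rule l2_norm_Times_finite[OF _ v, symmetric]) simp
      finally have "(l2_norm J ?d)\<^sup>2 \<le> (\<epsilon> / 2 * l2_norm J v)\<^sup>2"
        by (simp only: power_mult_distrib)
      then show "l2_dist J (T y v) (T z v) \<le> \<epsilon> / 2 * l2_norm J v"
        unfolding l2_dist_def by (rule power2_le_imp_le) (use \<epsilon> l2_norm_nonneg[of J v] in simp)
    qed (use \<epsilon> in simp)
    then show ?thesis
      using \<epsilon> by simp
  qed
  moreover have "openin (top_of_set (U l \<inter> U m)) (W \<inter> ball y \<delta>)"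
    by (rule openin_Int_open[OF W(1) open_ball])
  ultimately show "\<exists>W. openin (top_of_set (U l \<inter> U m)) W \<and> y \<in> W \<and> (\<forall>z\<in>W. op_dist J (T y) (T z) < \<epsilon>)"
    using W(2) \<delta> by (intro exI[of _ "W \<inter> ball y \<delta>"]) auto
qed

lemma continuous_chart_change:
  "continuous_map (prod_topology (top_of_set (U l \<inter> U m)) (l2_topology J))
     (prod_topology (top_of_set (U l \<inter> U m)) (l2_topology J)) (\<lambda>(y, v). (y, T y v))"
  using continuous_map_unitary_action[OF continuous_transition_P] continuous_map_fst
  unfolding continuous_map_pairwise o_def case_prod_unfold by auto

text \<open>A nonzero matrix entry at \<open>((x, i), (x', i'))\<close> forces the sheets with labels \<open>x\<close> and \<open>x'\<close>
  to meet over \<open>y\<close>, so \<open>x\<close> and \<open>x'\<close> are close as soon as every label is close to its sheet.\<close>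

lemma propagation_transition_P:
  assumes y: "y \<in> U l \<inter> U m"
    and C: "\<And>x. x \<in> F \<Longrightarrow> dist x (lift l \<rho> y x) \<le> C"
    and D: "\<And>x. x \<in> F \<Longrightarrow> dist x (lift m \<sigma> y x) \<le> D"
  shows "propagation J index_dist (T y) \<le> ereal (C + D + real n)"
  unfolding propagation_def
proof (rule SUP_least)
  fix p
  assume "p \<in> {(j, j'). j \<in> J \<and> j' \<in> J \<and> T y (basis_vec j') j \<noteq> 0}"
  then obtain x i x' i' where p: "p = ((x, i), (x', i'))" "x \<in> F" "i < n" "x' \<in> F" "i' < n"
    "T y (basis_vec (x', i')) (x, i) \<noteq> 0"
    by auto
  have e: "basis_vec (x', i') \<in> l2 J"
  proof (rule l2I)
    show "basis_vec (x', i') j = 0" if "j \<notin> J" for j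
      using that p by (auto simp: basis_vec_def)
    show "(\<lambda>j. (cmod (basis_vec (x', i') j))\<^sup>2) summable_on J"
      by (rule finite_nonzero_values_imp_summable_on, rule finite_subset[of _ "{(x', i')}"])
        (auto simp: basis_vec_def split: if_splits)
  qed
  have "relabel l \<rho> m \<sigma> y x = x'"
  proof (rule ccontr)
    assume "relabel l \<rho> m \<sigma> y x \<noteq> x'"
    then have "(\<lambda>i. basis_vec (x', i') (relabel l \<rho> m \<sigma> y x, i)) = (\<lambda>i. 0)"
      by (auto simp: basis_vec_def)
    then have "(\<lambda>i. T y (basis_vec (x', i')) (x, i)) = G (lift l \<rho> y x) (\<lambda>i. 0)"
      using transition_P_slice[OF y e p(2)] by simp
    also have "\<dots> = (\<lambda>i. 0)"
      by (rule unitary_zero[OF fibre_isometry_E_transition[OF l m]])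
        (use y lift_in_sheet(2)[OF l \<rho> _ p(2)] in auto)
    finally show False
      using p(6) by (simp add: fun_eq_iff)
  qed
  then have "lift m \<sigma> y x' = lift l \<rho> y x"
    using lift_relabel[OF l m \<rho> \<sigma> y p(2)] by simp
  then have "dist x x' \<le> C + D"
    using C[OF p(2)] D[OF p(4)] dist_triangle2[of x x' "lift l \<rho> y x"] by simp
  moreover have "\<bar>real i - real i'\<bar> \<le> real n"
    using p(3,5) by linarith
  ultimately show "(case p of (j, j') \<Rightarrow> ereal (index_dist j j')) \<le> ereal (C + D + real n)"
    by (simp add: p(1) index_dist_def)
qed

end

section \<open>The induced trivializations\<close>

lemma topology_P: "total P = topology_generated_by
    {{p \<in> pushforward_space E \<pi>. fst p \<in> U l \<and> (fst p, chart l (\<lambda>x. x) p) \<in> W} | l W.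
      l \<in> \<Lambda> \<and> openin (prod_topology (top_of_set (U l)) (l2_topology J)) W}"
  and proj_P: "proj P = fst"
  by (simp_all add: pushforward_def)

lemma over_P: "over P V = {p \<in> pushforward_space E \<pi>. fst p \<in> V}"
  unfolding over_def topspace_P proj_P ..

lemma openin_P_generator:
  assumes "l \<in> \<Lambda>" "openin (prod_topology (top_of_set (U l)) (l2_topology J)) W"
  shows "openin (total P) {p \<in> pushforward_space E \<pi>. fst p \<in> U l \<and> (fst p, chart l (\<lambda>x. x) p) \<in> W}"
  unfolding topology_P using assms by (intro topology_generated_by_Basis) blast

lemma bij_betw_trivial_relabelling: "bij_betw (\<lambda>x. x) F F"
  by (simp add: bij_betw_def)

lemma chart_in_l2:
  assumes "l \<in> \<Lambda>" "bij_betw \<rho> F F" "p \<in> pushforward_space E \<pi>" "fst p \<in> U l"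
  shows "chart l \<rho> p \<in> l2 J"
  using fibre_isometry_l2[OF fibre_isometry_chart[OF assms(1,2,4)], of p] assms(3) by (simp add: fiber_P)

lemma continuous_proj_P: "continuous_map (total P) euclidean (proj P)"
  unfolding continuous_map topspace_P proj_P
proof (intro conjI allI impI)
  fix V :: "'y set"
  assume "openin euclidean V"
  then have V: "openin (prod_topology (top_of_set (U l)) (l2_topology J)) ((U l \<inter> V) \<times> l2 J)" for l
    by (simp add: openin_prod_Times_iff openin_open_Int openin_topspace[of "l2_topology J", simplified])
  have "{p \<in> pushforward_space E \<pi>. fst p \<in> V} =
      (\<Union>l\<in>\<Lambda>. {p \<in> pushforward_space E \<pi>. fst p \<in> U l \<and> (fst p, chart l (\<lambda>x. x) p) \<in> (U l \<inter> V) \<times> l2 J})"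
    (is "?A = (\<Union>l\<in>\<Lambda>. ?B l)")
  proof
    show "?A \<subseteq> (\<Union>l\<in>\<Lambda>. ?B l)"
    proof
      fix p
      assume p: "p \<in> ?A"
      obtain l where l: "l \<in> \<Lambda>" "fst p \<in> U l"
        using cover_U by blast
      then show "p \<in> (\<Union>l\<in>\<Lambda>. ?B l)"
        using chart_in_l2[OF l(1) bij_betw_trivial_relabelling _ l(2)] p by blast
    qed
  qed auto
  also have "openin (total P) \<dots>"
    using openin_P_generator[OF _ V] by (intro openin_Union) blast
  finally show "openin (total P) {p \<in> pushforward_space E \<pi>. fst p \<in> V}" .
qed simp

text \<open>The generators of the topology make the unrelabelled chart continuous; relabelling is one
  of the changes of charts shown to be continuous before.\<close>

lemma continuous_chart:
  assumes l: "l \<in> \<Lambda>" and \<rho>: "bij_betw \<rho> F F"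
  shows "continuous_map (subtopology (total P) (over P (U l)))
    (prod_topology (top_of_set (U l)) (l2_topology J)) (\<lambda>p. (fst p, chart l \<rho> p))"
proof -
  note id = bij_betw_trivial_relabelling
  let ?X = "subtopology (total P) (over P (U l))" and ?Y = "prod_topology (top_of_set (U l)) (l2_topology J)"
  have X: "topspace ?X = {p \<in> pushforward_space E \<pi>. fst p \<in> U l}"
    using over_P topspace_P by auto
  have "continuous_map ?X ?Y (\<lambda>p. (fst p, chart l (\<lambda>x. x) p))"
    unfolding continuous_map
  proof (intro conjI allI impI)
    show "(\<lambda>p. (fst p, chart l (\<lambda>x. x) p)) ` topspace ?X \<subseteq> topspace ?Y"
      unfolding X using chart_in_l2[OF l id] by auto
    fix W
    assume "openin ?Y W"
    then have "openin ?X ({p \<in> pushforward_space E \<pi>. fst p \<in> U l \<and> (fst p, chart l (\<lambda>x. x) p) \<in> W} \<inter> over P (U l))"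
      using openin_P_generator[OF l] unfolding openin_subtopology by blast
    moreover have "{p \<in> pushforward_space E \<pi>. fst p \<in> U l \<and> (fst p, chart l (\<lambda>x. x) p) \<in> W} \<inter> over P (U l)
        = {p \<in> topspace ?X. (fst p, chart l (\<lambda>x. x) p) \<in> W}"
      unfolding X unfolding over_P by blast
    ultimately show "openin ?X {p \<in> topspace ?X. (fst p, chart l (\<lambda>x. x) p) \<in> W}"
      by (simp only:)
  qed
  moreover have "continuous_map ?Y ?Y
      (\<lambda>(y, v). (y, transition J P (chart l \<rho>) (chart l (\<lambda>x. x)) y v))"
    using continuous_chart_change[OF l l \<rho> id] by simp
  ultimately have "continuous_map ?X ?Y
      ((\<lambda>(y, v). (y, transition J P (chart l \<rho>) (chart l (\<lambda>x. x)) y v)) \<circ> (\<lambda>p. (fst p, chart l (\<lambda>x. x) p)))"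
    by (rule continuous_map_compose)
  then show ?thesis
  proof (rule continuous_map_eq)
    fix p
    assume "p \<in> topspace ?X"
    then have p: "p \<in> fiber P (fst p)" "fst p \<in> U l"
      unfolding X fiber_P by auto
    show "((\<lambda>(y, v). (y, transition J P (chart l \<rho>) (chart l (\<lambda>x. x)) y v)) \<circ> (\<lambda>p. (fst p, chart l (\<lambda>x. x) p))) p
        = (fst p, chart l \<rho> p)"
      using transition_apply[OF fibre_isometry_chart[OF l id p(2)] p(1)] by simp
  qed
qed

text \<open>The preimage of a generator belonging to \<open>m\<close> under the inverse of a chart over \<open>U l\<close> is its
  preimage under a change of charts, defined over the open set \<open>U l \<inter> U m\<close>.\<close>

lemma continuous_chart_inverse:
  assumes l: "l \<in> \<Lambda>" and \<rho>: "bij_betw \<rho> F F"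
  shows "continuous_map (prod_topology (top_of_set (U l)) (l2_topology J)) (total P)
    (\<lambda>(y, v). inv_into (fiber P y) (chart l \<rho>) v)" (is "continuous_map ?Y _ ?g")
proof -
  have g: "?g q \<in> pushforward_space E \<pi>" "fst (?g q) = fst q" if "q \<in> topspace ?Y" for q
    using that fibre_isometry_inv(1)[OF fibre_isometry_chart[OF l \<rho>]] by (auto simp: fiber_P)
  show ?thesis
    unfolding topology_P
  proof (rule continuous_on_generated_topo)
    show "?g ` topspace ?Y \<subseteq> \<Union> {{p \<in> pushforward_space E \<pi>. fst p \<in> U l \<and> (fst p, chart l (\<lambda>x. x) p) \<in> W} | l W.
        l \<in> \<Lambda> \<and> openin (prod_topology (top_of_set (U l)) (l2_topology J)) W}"
      using g(1) topspace_P unfolding topology_P topology_generated_by_topspace by blast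
    fix N
    assume "N \<in> {{p \<in> pushforward_space E \<pi>. fst p \<in> U l \<and> (fst p, chart l (\<lambda>x. x) p) \<in> W} | l W.
        l \<in> \<Lambda> \<and> openin (prod_topology (top_of_set (U l)) (l2_topology J)) W}"
    then obtain m W where m: "m \<in> \<Lambda>"
      and W: "openin (prod_topology (top_of_set (U m)) (l2_topology J)) W"
      and N: "N = {p \<in> pushforward_space E \<pi>. fst p \<in> U m \<and> (fst p, chart m (\<lambda>x. x) p) \<in> W}"
      by blast
    let ?Z = "prod_topology (top_of_set (U m \<inter> U l)) (l2_topology J)"
    let ?t = "\<lambda>(y, v). (y, transition J P (chart m (\<lambda>x. x)) (chart l \<rho>) y v)"
    have t: "continuous_map ?Z ?Z ?t"
      by (rule continuous_chart_change[OF m l bij_betw_trivial_relabelling \<rho>])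
    have Z: "?Z = subtopology (prod_topology (top_of_set (U k)) (l2_topology J)) ((U m \<inter> U l) \<times> l2 J)"
      if "k \<in> {l, m}" for k
    proof -
      have "U k \<inter> (U m \<inter> U l) = U m \<inter> U l"
        using that by blast
      moreover have "subtopology (l2_topology J) (l2 J) = l2_topology J"
        using subtopology_topspace[of "l2_topology J"] by simp
      ultimately show ?thesis
        by (simp add: subtopology_Times subtopology_subtopology)
    qed
    have "openin ?Z (W \<inter> ((U m \<inter> U l) \<times> l2 J))"
      unfolding Z[of m, simplified] by (rule openin_subtopology_Int[OF W])
    then have "openin ?Z {q \<in> topspace ?Z. ?t q \<in> W \<inter> ((U m \<inter> U l) \<times> l2 J)}"
      by (rule openin_continuous_map_preimage[OF t])
    moreover have "openin ?Y ((U m \<inter> U l) \<times> l2 J)"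
      using open_U[OF m] open_U[OF l]
      using openin_topspace[of "l2_topology J"] openin_open_Int[OF open_U[OF m], of "U l"]
      by (simp add: openin_prod_Times_iff Int_commute)
    ultimately have "openin ?Y {q \<in> topspace ?Z. ?t q \<in> W \<inter> ((U m \<inter> U l) \<times> l2 J)}"
      unfolding Z[of l, simplified] by (rule openin_trans_full)
    moreover have "{q \<in> topspace ?Z. ?t q \<in> W \<inter> ((U m \<inter> U l) \<times> l2 J)} = ?g -` N \<inter> topspace ?Y"
    proof -
      have "?t q \<in> (U m \<inter> U l) \<times> l2 J" if "q \<in> topspace ?Z" for q
        using continuous_map_image_subset_topspace[OF t] that by auto
      moreover have "(?t (y, v) \<in> W) = ((fst (?g (y, v)), chart m (\<lambda>x. x) (?g (y, v))) \<in> W)"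
        if "(y, v) \<in> topspace ?Y" for y v
        using g(2)[OF that] that by (simp add: transition_def)
      ultimately show ?thesis
        unfolding N using g by fastforce
    qed
    ultimately show "openin ?Y (?g -` N \<inter> topspace ?Y)"
      by (simp only:)
  qed
qed

lemma unitary_trivialization_chart:
  assumes l: "l \<in> \<Lambda>" and \<rho>: "bij_betw \<rho> F F"
  shows "unitary_trivialization J P (U l) (chart l \<rho>)"
proof -
  let ?X = "subtopology (total P) (over P (U l))" and ?Y = "prod_topology (top_of_set (U l)) (l2_topology J)"
  let ?g = "\<lambda>(y, v). inv_into (fiber P y) (chart l \<rho>) v"
  have X: "topspace ?X = {p \<in> pushforward_space E \<pi>. fst p \<in> U l}"
    using over_P topspace_P by auto
  have inv: "?g (y, v) \<in> fiber P y" "chart l \<rho> (?g (y, v)) = v" if "y \<in> U l" "v \<in> l2 J" for y v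
    using fibre_isometry_inv[OF fibre_isometry_chart[OF l \<rho> that(1)] that(2)] by auto
  have "homeomorphic_maps ?X ?Y (\<lambda>p. (fst p, chart l \<rho> p)) ?g"
    unfolding homeomorphic_maps_def
  proof (intro conjI ballI)
    show "continuous_map ?X ?Y (\<lambda>p. (fst p, chart l \<rho> p))"
      by (rule continuous_chart[OF l \<rho>])
    show "continuous_map ?Y ?X ?g"
      using continuous_chart_inverse[OF l \<rho>] inv(1)
      by (auto simp: continuous_map_in_subtopology fiber_P over_P)
    show "?g (fst p, chart l \<rho> p) = p" if "p \<in> topspace ?X" for p
    proof -
      have "p \<in> fiber P (fst p)" "fst p \<in> U l"
        using that unfolding X fiber_P by auto
      then show ?thesis
        using fibre_isometry_chart[OF l \<rho>, of "fst p"] by (simp add: fibre_isometry_def bij_betw_def)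
    qed
    show "(fst (?g q), chart l \<rho> (?g q)) = q" if "q \<in> topspace ?Y" for q
      using that inv by (cases q) (auto simp: fiber_P)
  qed
  then have "homeomorphic_map ?X ?Y (\<lambda>p. (fst p, chart l \<rho> p))"
    using homeomorphic_map_maps by blast
  then show ?thesis
    using fibre_isometry_chart[OF l \<rho>] unfolding unitary_trivialization_def fibre_isometry_def proj_P
    by blast
qed

lemma hilbert_bundle_P:
  assumes "\<And>l. l \<in> \<Lambda> \<Longrightarrow> bij_betw (\<rho> l) F F"
  shows "hilbert_bundle J P \<Lambda> U (\<lambda>l. chart l (\<rho> l))"
  unfolding hilbert_bundle_def
  by (intro conjI ballI continuous_proj_P open_U cover_U unitary_trivialization_chart
      continuous_transition_P assms)

section \<open>Labelling the sheets by nearby points of the basepoint fibre\<close>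

text \<open>The given labels may be permuted arbitrarily over each member of the cover, and with them the
  transition functions can have infinite propagation.  The labels are therefore chosen anew, by the
  positions of the sheets in \<open>X\<close>.\<close>

definition near_labelling :: "'l \<Rightarrow> ('x \<Rightarrow> 'x) \<Rightarrow> bool" where
  "near_labelling l \<rho> \<longleftrightarrow> bij_betw \<rho> F F \<and> (\<exists>C. \<forall>y\<in>U l. \<forall>x\<in>F. dist x (lift l \<rho> y x) \<le> C)"

text \<open>Each sheet is isometric to a subset of the bounded space \<open>Y\<close>, so it suffices to control one
  point in each sheet.\<close>

lemma near_labellingI:
  assumes bounded: "bounded (UNIV :: 'y set)" and l: "l \<in> \<Lambda>" and \<rho>: "bij_betw \<rho> F F"
    and y: "y \<in> U l" and C: "\<And>x. x \<in> F \<Longrightarrow> dist x (lift l \<rho> y x) \<le> C"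
  shows "near_labelling l \<rho>"
  unfolding near_labelling_def
proof (intro conjI exI ballI)
  fix z x
  assume z: "z \<in> U l" and x: "x \<in> F"
  have "dist x (lift l \<rho> z x) \<le> dist x (lift l \<rho> y x) + dist (lift l \<rho> y x) (lift l \<rho> z x)"
    by (rule dist_triangle)
  also have "\<dots> \<le> C + diameter (UNIV :: 'y set)"
    using C[OF x] dist_lift[OF l \<rho> y z x] diameter_bounded_bound[OF bounded, of y z] by simp
  finally show "dist x (lift l \<rho> z x) \<le> C + diameter (UNIV :: 'y set)" .
qed (rule \<rho>)

text \<open>Over \<open>y\<close>, the new label in \<open>U m\<close> of a point is its label in \<open>U l\<close>, so the bound for \<open>U l\<close>
  holds for one point of each sheet over \<open>U m\<close>.\<close>

lemma near_labelling_transport: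
  assumes bounded: "bounded (UNIV :: 'y set)" and l: "l \<in> \<Lambda>" and m: "m \<in> \<Lambda>"
    and y: "y \<in> U l \<inter> U m" and near: "near_labelling l \<rho>"
  shows "near_labelling m (relabel l \<rho> m (\<lambda>x. x) y)"
proof -
  note id = bij_betw_trivial_relabelling
  obtain C where \<rho>: "bij_betw \<rho> F F" and C: "\<And>x. x \<in> F \<Longrightarrow> dist x (lift l \<rho> y x) \<le> C"
    using near y unfolding near_labelling_def by blast
  let ?\<sigma> = "relabel l \<rho> m (\<lambda>x. x) y"
  have \<sigma>: "bij_betw ?\<sigma> F F"
    by (rule bij_betw_relabel[OF l m \<rho> id y])
  have "dist x (lift m ?\<sigma> y x) \<le> C" if x: "x \<in> F" for x
    using C[OF x] lift_relabel[OF l m \<rho> id y x] by (simp add: lift_def)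
  then show ?thesis
    using near_labellingI[OF bounded m \<sigma>] y by blast
qed

text \<open>The members of the cover that have such a labelling and those that have none form two open sets
  covering \<open>Y\<close>.  They are disjoint, as labellings are carried along overlaps, and \<open>y0\<close> lies in the
  first; so the second is empty.  An empty member of the cover is labelled vacuously.\<close>

lemma near_labelling_exists:
  assumes F: "F = \<pi> -` {y0}" and connected: "connected (UNIV :: 'y set)"
    and bounded: "bounded (UNIV :: 'y set)" and l: "l \<in> \<Lambda>"
  shows "\<exists>\<rho>. near_labelling l \<rho>"
proof (rule ccontr)
  note id = bij_betw_trivial_relabelling
  assume bad: "\<nexists>\<rho>. near_labelling l \<rho>"
  let ?A = "\<Union>m\<in>{m\<in>\<Lambda>. \<exists>\<rho>. near_labelling m \<rho>}. U m"
  let ?B = "\<Union>m\<in>{m\<in>\<Lambda>. \<nexists>\<rho>. near_labelling m \<rho>}. U m"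
  have "open ?A" "open ?B"
    using open_U by (auto intro: open_UN)
  moreover have "?A \<inter> ?B = {}"
  proof (rule equals0I)
    fix y
    assume "y \<in> ?A \<inter> ?B"
    then obtain k m \<rho> where "k \<in> \<Lambda>" "m \<in> \<Lambda>" "y \<in> U k \<inter> U m" "near_labelling k \<rho>"
      and m: "\<nexists>\<rho>. near_labelling m \<rho>"
      by auto
    then have "near_labelling m (relabel k \<rho> m (\<lambda>x. x) y)"
      by (intro near_labelling_transport[OF bounded])
    then show False
      using m by blast
  qed
  moreover have "?A \<union> ?B = UNIV"
    unfolding UN_Un[symmetric] Collect_disj_eq[symmetric] conj_disj_distribL[symmetric]
    by (simp only: simp_thms Collect_mem_eq cover_U)
  ultimately have "?A = {} \<or> ?B = {}"
    using connectedD[OF connected, of ?A ?B] by (simp only: Int_UNIV_right subset_refl simp_thms)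
  moreover have "y0 \<in> ?A"
  proof -
    obtain m where m: "m \<in> \<Lambda>" "y0 \<in> U m"
      using cover_U by blast
    have bij: "bij_betw (lift m (\<lambda>x. x) y0) F F"
      using bij_betw_lift[OF m(1) id m(2)] F by simp
    \<comment> \<open>This relabelling gives the sheet through \<open>x \<in> F\<close> the label \<open>x\<close>.\<close>
    let ?\<rho> = "inv_into F (lift m (\<lambda>x. x) y0)"
    have \<rho>: "bij_betw ?\<rho> F F"
      by (rule bij_betw_inv_into[OF bij])
    have "dist x (lift m ?\<rho> y0 x) \<le> 0" if "x \<in> F" for x
      using bij_betw_inv_into_right[OF bij that] by (simp add: lift_def)
    then show ?thesis
      using near_labellingI[OF bounded m(1) \<rho> m(2)] m by blast
  qed
  ultimately have "?B = {}"
    by blast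
  then have "U l = {}"
    using l bad by blast
  then have "near_labelling l (\<lambda>x. x)"
    using id by (simp add: near_labelling_def)
  then show False
    using bad by blast
qed

lemma Metric_space_index_dist: "Metric_space J index_dist"
proof
  fix p q r :: "'x \<times> nat"
  obtain x i x' i' x'' i'' where pqr: "p = (x, i)" "q = (x', i')" "r = (x'', i'')"
    by (cases p, cases q, cases r)
  show "0 \<le> index_dist p q"
    by (simp add: pqr index_dist_def)
  show "index_dist p q = index_dist q p"
    by (simp add: pqr index_dist_def dist_commute abs_minus_commute)
  show "(index_dist p q = 0) = (p = q)"
    by (simp add: pqr index_dist_def add_nonneg_eq_0_iff)
  show "index_dist p r \<le> index_dist p q + index_dist q r"
    using dist_triangle[of x x'' x'] abs_triangle_ineq[of "real i - real i'" "real i' - real i''"]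
    by (simp add: pqr index_dist_def)
qed

lemma hilbert_bundle_with_end_P:
  assumes F: "countable F" and \<rho>: "\<And>l. l \<in> \<Lambda> \<Longrightarrow> near_labelling l (\<rho> l)"
  shows "hilbert_bundle_with_end J index_dist P \<Lambda> U (\<lambda>l. chart l (\<rho> l))"
  unfolding hilbert_bundle_with_end_def
proof (intro conjI ballI)
  have bij: "bij_betw (\<rho> l) F F" if "l \<in> \<Lambda>" for l
    using \<rho>[OF that] by (simp add: near_labelling_def)
  show "countable J"
    using F by simp
  show "Metric_space J index_dist"
    by (rule Metric_space_index_dist)
  show "hilbert_bundle J P \<Lambda> U (\<lambda>l. chart l (\<rho> l))"
    by (rule hilbert_bundle_P[OF bij])
  fix l m
  assume l: "l \<in> \<Lambda>" and m: "m \<in> \<Lambda>"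
  obtain C where C: "\<And>y x. y \<in> U l \<Longrightarrow> x \<in> F \<Longrightarrow> dist x (lift l (\<rho> l) y x) \<le> C"
    using \<rho>[OF l] unfolding near_labelling_def by blast
  obtain D where D: "\<And>y x. y \<in> U m \<Longrightarrow> x \<in> F \<Longrightarrow> dist x (lift m (\<rho> m) y x) \<le> D"
    using \<rho>[OF m] unfolding near_labelling_def by blast
  show "continuous_map (top_of_set (U l \<inter> U m)) (end_topology J index_dist)
      (transition J P (chart l (\<rho> l)) (chart m (\<rho> m)))"
  proof (rule continuous_map_into_end_topology)
    show "continuous_map (top_of_set (U l \<inter> U m)) (unitary_topology J)
        (transition J P (chart l (\<rho> l)) (chart m (\<rho> m)))"
      by (rule continuous_transition_P[OF l m bij[OF l] bij[OF m]])
    fix y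
    assume "y \<in> topspace (top_of_set (U l \<inter> U m))"
    then have "y \<in> U l \<inter> U m"
      by simp
    then show "propagation J index_dist (transition J P (chart l (\<rho> l)) (chart m (\<rho> m)) y)
        \<le> ereal (C + D + real n)"
      using C D by (intro propagation_transition_P[OF l m bij[OF l] bij[OF m]]) auto
  qed
qed

end

theorem theorem4p8:
  fixes E :: "('x::metric_space, 'e) hfamily"
    and \<pi> :: "'x \<Rightarrow> 'y::metric_space"
    and y0 :: 'y and F :: "'x set" and n :: nat
    and \<Lambda> :: "'l set" and U :: "'l \<Rightarrow> 'y set"
    and S :: "'l \<Rightarrow> 'x \<Rightarrow> 'x set"
    and \<phi> :: "'l \<Rightarrow> 'e \<Rightarrow> nat \<Rightarrow> complex"
  assumes connected_X: "connected (UNIV :: 'x set)"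
    and connected_Y: "connected (UNIV :: 'y set)"
    and bundle_E: "hermitian_vector_bundle n E"
    and covering: "covering_space UNIV \<pi> UNIV"
    and fibre: "F = \<pi> -` {y0}" "countable F"
    and cover: "\<And>l. l \<in> \<Lambda> \<Longrightarrow> open (U l)" "(\<Union>l\<in>\<Lambda>. U l) = UNIV"
    and trivial_\<pi>: "covering_atlas \<pi> F \<Lambda> U S"
    and isometry: "\<And>l x a b. \<lbrakk>l \<in> \<Lambda>; x \<in> F; a \<in> S l x; b \<in> S l x\<rbrakk> \<Longrightarrow> dist (\<pi> a) (\<pi> b) = dist a b"
    and trivial_E: "\<And>l. l \<in> \<Lambda> \<Longrightarrow> unitary_trivialization {..<n} E (\<pi> -` U l) (\<phi> l)"
    and equicontinuous: "\<And>l m. \<lbrakk>l \<in> \<Lambda>; m \<in> \<Lambda>\<rbrakk> \<Longrightarrow>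
      equicontinuous_family (F \<times> F) (\<lambda>(x, y). S l x \<inter> S m y) (op_dist {..<n})
        (\<lambda>_. transition {..<n} E (\<phi> l) (\<phi> m))"
    and compact_Y: "compact (UNIV :: 'y set)"
  shows "\<exists>\<rho>. (\<forall>l\<in>\<Lambda>. bij_betw (\<rho> l) F F) \<and>
    hilbert_bundle_with_end (F \<times> {..<n}) index_dist (pushforward n E \<pi> F \<Lambda> U S \<phi>) \<Lambda> U
      (\<lambda>l. induced_trivialization \<pi> F (\<lambda>x. S l (\<rho> l x)) (\<phi> l))"
proof -
  interpret pushforward_atlas E \<pi> F n \<Lambda> U S \<phi>
    by (unfold_locales; fact assms)
  have "\<forall>l\<in>\<Lambda>. \<exists>\<rho>. near_labelling l \<rho>"
    using near_labelling_exists[OF fibre(1) connected_Y compact_imp_bounded[OF compact_Y]] by blast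
  then obtain \<rho> where \<rho>: "\<And>l. l \<in> \<Lambda> \<Longrightarrow> near_labelling l (\<rho> l)"
    using bchoice[of \<Lambda> near_labelling] by blast
  then have "\<forall>l\<in>\<Lambda>. bij_betw (\<rho> l) F F"
    by (simp add: near_labelling_def)
  then show ?thesis
    using hilbert_bundle_with_end_P[OF fibre(2) \<rho>] by blast
qed

end
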